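(* Let $M$ be a connected, compact complex manifold of complex dimension $n\ge2$ endowed with a Hermitian metric $\omega$ such that $S^{Ch}(\omega)=\Gamma(\{\omega\})<0$, and let $f_0$ be the eccentricity function of $\omega$. Then there exists $g\in C^{\infty}(M,\mathbb{R})$ with $\int_M g f_0\frac{\omega^n}{n!}<0$ such that $g$ is not the Chern scalar curvature of any metric conformal to $\omega$.
   Context: Hermitian metrics $h$ on $M$ are identified with their fundamental $(1,1)$-forms $\omega=h(J\cdot,\cdot)$, written locally as $\omega=\sqrt{-1}\,\omega_{i\bar j}\,dz_i\wedge d\overline{z_j}$ with $\omega_{i\bar j}=h(\partial_{z_i},\partial_{\overline{z_j}})$. The Chern scalar curvature of $\omega$ is the function $S^{Ch}(\omega)=\mathrm{tr}_\omega Ric^{(1)}(\omega)=\omega^{i\bar j}\omega^{k\bar l}R_{i\bar jk\bar l}$, where $R_{i\bar jk\bar l}$ are the components of the curvature of the Chern connection and $Ric^{(1)}(\omega)=\sqrt{-1}\,\omega^{k\bar l}R_{i\bar jk\bar l}\,dz_i\wedge d\overline{z_j}$ is the first Chern-Ricci form (locally $-\sqrt{-1}\,\partial\bar\partial\log\det(\omega_{k\bar l})$). The Chern Laplacian is $\Delta_\omega^{Ch}u=2\sqrt{-1}\,\mathrm{tr}_\omega\bar\partial\partial u$, locally $-2\omega^{i\bar j}\frac{\partial^2u}{\partial z_i\partial\overline{z_j}}$, for $u\in C^\infty(M,\mathbb{R})$. Its formal $L^2$-adjoint $(\Delta_\omega^{Ch})^*$ with respect to the volume form $\frac{\omega^n}{n!}$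 has one-dimensional kernel; the eccentricity function $f_0\in C^\infty(M,\mathbb{R})$ of $\omega$ is the unique element of $\ker((\Delta_\omega^{Ch})^* )$ with $\int_M f_0\frac{\omega^n}{n!}=Vol(M,\omega)=\int_M\frac{\omega^n}{n!}$; it is known that $f_0>0$. The conformal class of $\omega$ is $\{\omega\}=\{\exp(2u/n)\,\omega : u\in C^\infty(M,\mathbb{R})\}$; a metric $\omega_1$ is conformal to $\omega$ if $\omega_1\in\{\omega\}$. A Hermitian metric $\eta$ is Gauduchon if $\partial\bar\partial\eta^{n-1}=0$. For $M$ compact with $n\ge2$, each conformal class contains a unique Gauduchon metric $\eta$ of volume $\int_M\frac{\eta^n}{n!}=1$ (Gauduchon). The Gauduchon degree of $\{\omega\}$ is $\Gamma(\{\omega\})=\int_M S^{Ch}(\eta)\frac{\eta^n}{n!}$, where $\eta\in\{\omega\}$ is this Gauduchon metric. The hypothesis $S^{Ch}(\omega)=\Gamma(\{\omega\})$ means that $S^{Ch}(\omega)$ is constant, equal to $\Gamma(\{\omega\})$. *)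

theory Defs
  imports "HOL-Analysis.Analysis"
begin

section \<open>Calculus on open subsets of complex coordinate space\<close>

text \<open>The set \<open>S\<close> is always open below, so derivatives at points of \<open>S\<close> do not depend on the
  values of the function outside \<open>S\<close>.  As usual, all directional derivatives of \<open>f\<close> are required
  to be of class \<open>C^k\<close> for \<open>f\<close> to be of class \<open>C^(k+1)\<close>.\<close>

primrec Ck_on :: "nat \<Rightarrow> 'a::real_normed_vector set \<Rightarrow> ('a \<Rightarrow> 'b::real_normed_vector) \<Rightarrow> bool" where
  "Ck_on 0 S f \<longleftrightarrow> continuous_on S f"
| "Ck_on (Suc k) S f \<longleftrightarrow>
     (\<forall>x\<in>S. f differentiable (at x)) \<and> (\<forall>v. Ck_on k S (\<lambda>x. frechet_derivative f (at x) v))"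

definition smooth_on :: "'a::real_normed_vector set \<Rightarrow> ('a \<Rightarrow> 'b::real_normed_vector) \<Rightarrow> bool" where
  "smooth_on S f \<longleftrightarrow> (\<forall>k. Ck_on k S f)"

text \<open>The Wirtinger operators \<open>\<partial>/\<partial>z_i = (\<partial>/\<partial>x_i - \<i> \<partial>/\<partial>y_i)/2\<close> and
  \<open>\<partial>/\<partial>conj(z_i) = (\<partial>/\<partial>x_i + \<i> \<partial>/\<partial>y_i)/2\<close>.\<close>

definition dz :: "'n::finite \<Rightarrow> (complex^'n \<Rightarrow> complex) \<Rightarrow> complex^'n \<Rightarrow> complex" where
  "dz i f z = (frechet_derivative f (at z) (axis i 1)
               - \<i> * frechet_derivative f (at z) (axis i \<i>)) / 2"

definition dzbar :: "'n::finite \<Rightarrow> (complex^'n \<Rightarrow> complex) \<Rightarrow> complex^'n \<Rightarrow> complex" where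
  "dzbar i f z = (frechet_derivative f (at z) (axis i 1)
                  + \<i> * frechet_derivative f (at z) (axis i \<i>)) / 2"

definition holomorphic_map_on :: "(complex^'n::finite) set \<Rightarrow> (complex^'n \<Rightarrow> complex^'n) \<Rightarrow> bool" where
  "holomorphic_map_on S f \<longleftrightarrow>
     (\<forall>z\<in>S. \<exists>D. (f has_derivative D) (at z) \<and> (\<forall>a v. D (a *s v) = a *s D v))"


section \<open>Complex manifolds\<close>

text \<open>The manifold is the whole type \<open>'a\<close>, its complex dimension is \<open>CARD('n)\<close>.  A chart is a pair
  of its domain and its coordinate map (whose values outside the domain are irrelevant).\<close>

type_synonym ('a, 'n) chart = "'a set \<times> ('a \<Rightarrow> complex^'n)"

abbreviation chart_image :: "('a, 'n::finite) chart \<Rightarrow> (complex^'n) set" where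
  "chart_image c \<equiv> snd c ` fst c"

abbreviation chart_inv :: "('a, 'n::finite) chart \<Rightarrow> complex^'n \<Rightarrow> 'a" where
  "chart_inv c \<equiv> inv_into (fst c) (snd c)"

definition transition :: "('a, 'n::finite) chart \<Rightarrow> ('a, 'n) chart \<Rightarrow> complex^'n \<Rightarrow> complex^'n" where
  "transition c d = snd d \<circ> chart_inv c"

definition complex_atlas ::
    "('a::{t2_space,second_countable_topology}, 'n::finite) chart set \<Rightarrow> bool" where
  "complex_atlas A \<longleftrightarrow>
     (\<forall>c\<in>A. open (fst c) \<and> open (chart_image c) \<and>
             homeomorphism (fst c) (chart_image c) (snd c) (chart_inv c)) \<and>
     (\<Union>c\<in>A. fst c) = UNIV \<and>
     (\<forall>c\<in>A. \<forall>d\<in>A. holomorphic_map_on (snd c ` (fst c \<inter> fst d)) (transition c d))"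

definition smooth_fun :: "('a, 'n::finite) chart set \<Rightarrow> ('a \<Rightarrow> real) \<Rightarrow> bool" where
  "smooth_fun A u \<longleftrightarrow> (\<forall>c\<in>A. smooth_on (chart_image c) (u \<circ> chart_inv c))"

text \<open>Geometric quantities that do not depend on the coordinates are evaluated in an arbitrary chart
  around the point.\<close>

definition chart_at :: "('a, 'n::finite) chart set \<Rightarrow> 'a \<Rightarrow> ('a, 'n) chart" where
  "chart_at A p = (SOME c. c \<in> A \<and> p \<in> fst c)"


section \<open>Hermitian metrics\<close>

text \<open>A metric is given by its components: \<open>\<omega> c z $ i $ j\<close> is the component with indices \<open>i\<close> and
  \<open>conj(j)\<close> of \<open>\<omega>\<close> in the chart \<open>c\<close>, at the point with coordinates \<open>z \<in> chart_image c\<close>.\<close>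

type_synonym 'n local_metric = "complex^'n \<Rightarrow> complex^'n^'n"

type_synonym ('a, 'n) metric = "('a, 'n) chart \<Rightarrow> 'n local_metric"

definition hermitian_metric :: "('a, 'n::finite) chart set \<Rightarrow> ('a, 'n) metric \<Rightarrow> bool" where
  "hermitian_metric A \<omega> \<longleftrightarrow>
     (\<forall>c\<in>A. (\<forall>i j. smooth_on (chart_image c) (\<lambda>z. \<omega> c z $ i $ j)) \<and>
        (\<forall>z\<in>chart_image c.
           (\<forall>i j. \<omega> c z $ j $ i = cnj (\<omega> c z $ i $ j)) \<and>
           (\<forall>v. v \<noteq> 0 \<longrightarrow> 0 < Re (\<Sum>i\<in>UNIV. \<Sum>j\<in>UNIV. \<omega> c z $ i $ j * v $ i * cnj (v $ j))))) \<and>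
     (\<forall>c\<in>A. \<forall>d\<in>A. \<forall>p\<in>fst c \<inter> fst d. \<forall>i j.
        \<omega> c (snd c p) $ i $ j =
        (\<Sum>k\<in>UNIV. \<Sum>l\<in>UNIV. dz i (\<lambda>z. transition c d z $ k) (snd c p) *
            cnj (dz j (\<lambda>z. transition c d z $ l) (snd c p)) * \<omega> d (snd d p) $ k $ l))"

definition conformal :: "('a, 'n::finite) chart set \<Rightarrow> ('a, 'n) metric \<Rightarrow> ('a, 'n) metric \<Rightarrow> bool" where
  "conformal A \<omega> \<omega>' \<longleftrightarrow>
     (\<exists>u. smooth_fun A u \<and>
        (\<forall>c\<in>A. \<forall>z\<in>chart_image c.
           \<omega>' c z = exp (2 * u (chart_inv c z) / real CARD('n)) *\<^sub>R \<omega> c z))"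


section \<open>Chern connection, Chern scalar curvature, Chern Laplacian\<close>

text \<open>The components with upper indices satisfy
  \<open>\<Sum>j. metric_inv H z i j * H z $ k $ j = (if i = k then 1 else 0)\<close>; hence the transposition.\<close>

definition metric_inv :: "'n::finite local_metric \<Rightarrow> complex^'n \<Rightarrow> 'n \<Rightarrow> 'n \<Rightarrow> complex" where
  "metric_inv H z i j = matrix_inv (H z) $ j $ i"

text \<open>The Chern connection is the unique connection on the holomorphic tangent bundle that is
  compatible with the metric and whose (0,1)-part is the Cauchy-Riemann operator.  In a holomorphic
  frame its connection matrix is \<open>\<partial>H \<cdot> H^(-1)\<close>, i.e.
  \<open>\<nabla>_i \<partial>_k = \<Sum>p. chern_connection H i k p \<cdot> \<partial>_p\<close>, and its curvature is given by
  \<open>R(\<partial>_i, \<partial>_conj(j)) \<partial>_k = - \<Sum>p. \<partial>_conj(j) (chern_connection H i k p) \<cdot> \<partial>_p\<close>.\<close>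

definition chern_connection ::
    "'n::finite local_metric \<Rightarrow> 'n \<Rightarrow> 'n \<Rightarrow> 'n \<Rightarrow> complex^'n \<Rightarrow> complex" where
  "chern_connection H i k p z = (\<Sum>q\<in>UNIV. metric_inv H z p q * dz i (\<lambda>z. H z $ k $ q) z)"

definition chern_curvature ::
    "'n::finite local_metric \<Rightarrow> complex^'n \<Rightarrow> 'n \<Rightarrow> 'n \<Rightarrow> 'n \<Rightarrow> 'n \<Rightarrow> complex" where
  "chern_curvature H z i j k l =
     (\<Sum>p\<in>UNIV. - dzbar j (chern_connection H i k p) z * H z $ p $ l)"

text \<open>The full contraction is real, so taking the real part only changes the type.  The same remark
  applies to the Laplacian of a real function below.\<close>

definition chern_scalar :: "('a, 'n::finite) chart set \<Rightarrow> ('a, 'n) metric \<Rightarrow> 'a \<Rightarrow> real" where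
  "chern_scalar A \<omega> p =
     (let c = chart_at A p; H = \<omega> c; z = snd c p in
      Re (\<Sum>i\<in>UNIV. \<Sum>j\<in>UNIV. \<Sum>k\<in>UNIV. \<Sum>l\<in>UNIV.
            metric_inv H z i j * metric_inv H z k l * chern_curvature H z i j k l))"

definition chern_laplacian ::
    "('a, 'n::finite) chart set \<Rightarrow> ('a, 'n) metric \<Rightarrow> ('a \<Rightarrow> real) \<Rightarrow> 'a \<Rightarrow> real" where
  "chern_laplacian A \<omega> u p =
     (let c = chart_at A p; H = \<omega> c; z = snd c p in
      Re (- 2 * (\<Sum>i\<in>UNIV. \<Sum>j\<in>UNIV.
            metric_inv H z i j * dz i (dzbar j (\<lambda>z. complex_of_real (u (chart_inv c z)))) z)))"


section \<open>Integration against the volume form\<close>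

text \<open>Finite partitions of unity subordinate to the atlas, each function being listed together with
  a chart whose domain contains its support.\<close>

definition partition_of_unity ::
    "('a::topological_space, 'n::finite) chart set \<Rightarrow> (('a, 'n) chart \<times> ('a \<Rightarrow> real)) list \<Rightarrow> bool" where
  "partition_of_unity A P \<longleftrightarrow>
     (\<forall>(c, \<rho>)\<in>set P. c \<in> A \<and> continuous_on UNIV \<rho> \<and> (\<forall>p. 0 \<le> \<rho> p) \<and>
        closure {p. \<rho> p \<noteq> 0} \<subseteq> fst c) \<and>
     (\<forall>p. (\<Sum>(c, \<rho>)\<leftarrow>P. \<rho> p) = 1)"

text \<open>\<open>vol_integral A \<omega> f\<close> is the integral of \<open>f \<omega>^n/n!\<close> over a compact manifold, where locally
  \<open>\<omega>^n/n! = det(\<omega>) \<cdot> (\<i> dz_1 \<and> d conj(z_1)) \<and> \<dots> \<and> (\<i> dz_n \<and> d conj(z_n))\<close> and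
  \<open>\<i> dz \<and> d conj(z) = 2 dx \<and> dy\<close>.  On compact manifolds finite partitions of unity exist; by the
  change of variables formula the value does not depend on the one that is chosen.\<close>

definition vol_integral ::
    "('a::topological_space, 'n::finite) chart set \<Rightarrow> ('a, 'n) metric \<Rightarrow> ('a \<Rightarrow> real) \<Rightarrow> real" where
  "vol_integral A \<omega> f =
     (\<Sum>(c, \<rho>)\<leftarrow>(SOME P. partition_of_unity A P).
        set_lebesgue_integral lborel (chart_image c)
          (\<lambda>z. \<rho> (chart_inv c z) * f (chart_inv c z) * (2 ^ CARD('n) * Re (det (\<omega> c z)))))"

abbreviation volume :: "('a::topological_space, 'n::finite) chart set \<Rightarrow> ('a, 'n) metric \<Rightarrow> real" where
  "volume A \<omega> \<equiv> vol_integral A \<omega> (\<lambda>_. 1)"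


section \<open>Eccentricity function\<close>

definition formal_adjoint ::
    "('a::topological_space, 'n::finite) chart set \<Rightarrow> ('a, 'n) metric \<Rightarrow>
     (('a \<Rightarrow> real) \<Rightarrow> 'a \<Rightarrow> real) \<Rightarrow> (('a \<Rightarrow> real) \<Rightarrow> 'a \<Rightarrow> real) \<Rightarrow> bool" where
  "formal_adjoint A \<omega> L L' \<longleftrightarrow>
     (\<forall>v. smooth_fun A v \<longrightarrow> smooth_fun A (L' v)) \<and>
     (\<forall>u v. smooth_fun A u \<longrightarrow> smooth_fun A v \<longrightarrow>
        vol_integral A \<omega> (\<lambda>p. L u p * v p) = vol_integral A \<omega> (\<lambda>p. u p * L' v p))"

definition eccentricity_function ::
    "('a::topological_space, 'n::finite) chart set \<Rightarrow> ('a, 'n) metric \<Rightarrow> ('a \<Rightarrow> real) \<Rightarrow> bool" where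
  "eccentricity_function A \<omega> f0 \<longleftrightarrow>
     smooth_fun A f0 \<and>
     (\<exists>L'. formal_adjoint A \<omega> (chern_laplacian A \<omega>) L' \<and> L' f0 = (\<lambda>_. 0)) \<and>
     vol_integral A \<omega> f0 = volume A \<omega>"


section \<open>Gauduchon metrics and the Gauduchon degree\<close>

text \<open>A complex-valued differential form of degree \<open>k\<close> on an open subset of coordinate space is given
  by its values on lists of \<open>k\<close> coordinate vector fields, where \<open>Inl i\<close> stands for \<open>\<partial>/\<partial>z_i\<close> and
  \<open>Inr i\<close> for \<open>\<partial>/\<partial>conj(z_i)\<close>.  Values on lists of other lengths are irrelevant.  The wedge product
  is normalised so that \<open>(dz_i \<and> d conj(z_j)) (\<partial>/\<partial>z_i, \<partial>/\<partial>conj(z_j)) = 1\<close>.  Since coordinate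
  vector fields commute, \<open>del\<close> and \<open>delbar\<close> are the (1,0)- and (0,1)-parts of the usual formula for
  the exterior derivative.\<close>

type_synonym 'n form = "complex^'n \<Rightarrow> ('n + 'n) list \<Rightarrow> complex"

definition wedge :: "nat \<Rightarrow> nat \<Rightarrow> 'n::finite form \<Rightarrow> 'n form \<Rightarrow> 'n form" where
  "wedge k l \<alpha> \<beta> z xs =
     (\<Sum>\<sigma> | \<sigma> permutes {..<k + l}.
        of_int (sign \<sigma>) * \<alpha> z (map (\<lambda>m. xs ! \<sigma> m) [0..<k]) * \<beta> z (map (\<lambda>m. xs ! \<sigma> m) [k..<k + l]))
     / (fact k * fact l)"

definition del :: "'n::finite form \<Rightarrow> 'n form" where
  "del \<alpha> z xs = (\<Sum>m<length xs. (- 1) ^ m *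
     (case xs ! m of
        Inl i \<Rightarrow> dz i (\<lambda>z. \<alpha> z (take m xs @ drop (Suc m) xs)) z
      | Inr i \<Rightarrow> 0))"

definition delbar :: "'n::finite form \<Rightarrow> 'n form" where
  "delbar \<alpha> z xs = (\<Sum>m<length xs. (- 1) ^ m *
     (case xs ! m of
        Inl i \<Rightarrow> 0
      | Inr i \<Rightarrow> dzbar i (\<lambda>z. \<alpha> z (take m xs @ drop (Suc m) xs)) z))"

text \<open>The form \<open>\<i> \<Sum>i j. H_ij dz_i \<and> d conj(z_j)\<close> and its wedge powers.\<close>

fun fundamental_form :: "'n::finite local_metric \<Rightarrow> 'n form" where
  "fundamental_form H z [Inl i, Inr j] = \<i> * H z $ i $ j"
| "fundamental_form H z [Inr j, Inl i] = - \<i> * H z $ i $ j"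
| "fundamental_form H z _ = 0"

primrec fundamental_power :: "'n::finite local_metric \<Rightarrow> nat \<Rightarrow> 'n form" where
  "fundamental_power H 0 = (\<lambda>z xs. 1)"
| "fundamental_power H (Suc m) = wedge 2 (2 * m) (fundamental_form H) (fundamental_power H m)"

definition gauduchon :: "('a, 'n::finite) chart set \<Rightarrow> ('a, 'n) metric \<Rightarrow> bool" where
  "gauduchon A \<eta> \<longleftrightarrow>
     (\<forall>c\<in>A. \<forall>z\<in>chart_image c. \<forall>xs. length xs = 2 * CARD('n) \<longrightarrow>
        del (delbar (fundamental_power (\<eta> c) (CARD('n) - 1))) z xs = 0)"

definition gauduchon_degree ::
    "('a::topological_space, 'n::finite) chart set \<Rightarrow> ('a, 'n) metric \<Rightarrow> real" where
  "gauduchon_degree A \<omega> =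
     (THE d. \<exists>\<eta>. conformal A \<omega> \<eta> \<and> gauduchon A \<eta> \<and> volume A \<eta> = 1 \<and>
        d = vol_integral A \<eta> (chern_scalar A \<eta>))"

end

(* Let s < 0 be the constant Chern scalar curvature of omega, z a holomorphic coordinate around a point p
   with z(p) = 0, and let g be the constant s r^2 plus a large multiple of a bump function of radius r
   around p, such that g >= n C / 2 on |z| <= r, where C bounds 2 tr_omega of the Levi form of |z|^2.

   If g were the Chern scalar curvature of exp(2u/n) omega, then v = exp(-2u/n) would satisfy
   v (s - 2 tr_omega(del delbar u)) = g. At the maximum of v this gives v <= r^2. Hence v - |z|^2, which is
   positive at p and nonpositive for |z| = r, attains its maximum over |z| <= r at an interior point, and
   there the maximum principle gives -s v <= 0: contradiction.

   The integral of g f_0 is s r^2 Vol + O(r^(2n)), because f_0 has integral Vol; since n >= 2, it is negative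
   for small r. *)

theory Submission
  imports Defs "HOL-Complex_Analysis.Cauchy_Integral_Formula"
begin

section \<open>Functions of class C^k\<close>

text \<open>Two choices are out of reach: \<open>chern_scalar\<close> works at each point in the
  chart that \<open>chart_at\<close> returns, and \<open>vol_integral\<close> uses the partition of
  unity that \<open>SOME\<close> returns. So neither the coordinate z nor the chart of the bump can
  be taken to be the one in which curvature or integral is evaluated. Therefore |z|^2 is carried to
  an arbitrary chart, where the trace of its Levi form is still the trace of the inverse metric in
  the original chart, and the integral of the bump is estimated piece by piece, its support having
  size O(r) in every chart. Smoothness of |z|^2 and of the bump in other charts needs smooth
  transition maps, while \<open>complex_atlas\<close> only says that they are complex
  differentiable; Cauchy's formula closes this gap.

  The bound C does not depend on r, because the Levi form of |z|^2 does not. Hence the height of the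
  bump stays bounded as r tends to 0, and only its shrinking support enters the order r^(2n) of its
  integral.\<close>

lemma Ck_on_cong:
  assumes "open S" "\<And>x. x \<in> S \<Longrightarrow> f x = g x" "Ck_on k S f"
  shows "Ck_on k S g"
  using assms(2,3)
proof (induction k arbitrary: f g)
  case 0
  then show ?case by (simp cong: continuous_on_cong)
next
  case (Suc k)
  have der: "(g has_derivative frechet_derivative f (at x)) (at x)" if "x \<in> S" for x
  proof -
    have "(f has_derivative frechet_derivative f (at x)) (at x)"
      using Suc.prems(2) that by (simp add: frechet_derivative_works)
    then show ?thesis
      by (rule has_derivative_transform_within_open[OF _ assms(1) that]) (use Suc.prems(1) in auto)
  qed
  have eq: "frechet_derivative f (at x) = frechet_derivative g (at x)" if "x \<in> S" for x
    by (rule frechet_derivative_at[OF der[OF that]])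
  have "Ck_on k S (\<lambda>x. frechet_derivative g (at x) v)" for v
    using Suc.prems(2) eq by (simp add: Suc.IH[of "\<lambda>x. frechet_derivative f (at x) v"])
  then show ?case
    using der by (auto simp: differentiable_def)
qed

text \<open>Allows an explicit derivative D in place of the choice made by
  \<open>frechet_derivative\<close>; all later closure properties are proved through it.\<close>

lemma Ck_on_SucI:
  assumes "open S" "\<And>x. x \<in> S \<Longrightarrow> (f has_derivative D x) (at x)"
    and "\<And>v. Ck_on k S (\<lambda>x. D x v)"
  shows "Ck_on (Suc k) S f"
proof -
  have "frechet_derivative f (at x) = D x" if "x \<in> S" for x
    using assms(2) frechet_derivative_at that by metis
  then have "Ck_on k S (\<lambda>x. frechet_derivative f (at x) v)" for v
    using Ck_on_cong[OF assms(1) _ assms(3)[of v]] by auto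
  then show ?thesis
    using assms(2) by (auto simp: differentiable_def)
qed

lemma Ck_on_Suc_has_derivative:
  assumes "Ck_on (Suc k) S f" "x \<in> S"
  shows "(f has_derivative frechet_derivative f (at x)) (at x)"
  using assms by (simp add: frechet_derivative_works)

lemma Ck_on_pred: "Ck_on (Suc k) S f \<Longrightarrow> Ck_on k S f"
proof (induction k arbitrary: f)
  case 0
  then show ?case
    by (simp add: continuous_at_imp_continuous_on differentiable_imp_continuous_within)
next
  case (Suc k)
  then show ?case by simp
qed

lemma Ck_on_subset: "Ck_on k S f \<Longrightarrow> T \<subseteq> S \<Longrightarrow> Ck_on k T f"
  by (induction k arbitrary: f) (auto intro: continuous_on_subset)

lemma Ck_on_Un:
  "open S \<Longrightarrow> open T \<Longrightarrow> Ck_on k S f \<Longrightarrow> Ck_on k T f \<Longrightarrow> Ck_on k (S \<union> T) f"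
  by (induction k arbitrary: f) (auto intro: continuous_on_open_Un)

lemma Ck_on_const: "open S \<Longrightarrow> Ck_on k S (\<lambda>x. c)"
proof (induction k arbitrary: c)
  case (Suc k)
  then show ?case by (intro Ck_on_SucI[where D="\<lambda>x v. 0"]) auto
qed auto

lemma Ck_on_bounded_linear:
  assumes "open S" "bounded_linear h" "Ck_on k S f"
  shows "Ck_on k S (\<lambda>x. h (f x))"
  using assms(3)
proof (induction k arbitrary: f)
  case 0
  then show ?case
    using bounded_linear.continuous_on[OF assms(2)] by simp
next
  case (Suc k)
  show ?case
    using Suc by (intro Ck_on_SucI[OF assms(1) bounded_linear.has_derivative[OF assms(2)]
          Suc.IH[of "\<lambda>x. frechet_derivative f (at x) _"]])
      (auto simp: frechet_derivative_works)
qed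

lemma Ck_on_add:
  assumes "open S" "Ck_on k S f" "Ck_on k S g"
  shows "Ck_on k S (\<lambda>x. f x + g x)"
  using assms(2,3)
proof (induction k arbitrary: f g)
  case 0
  then show ?case by (auto intro: continuous_intros)
next
  case (Suc k)
  show ?case
    by (rule Ck_on_SucI[OF assms(1) has_derivative_add])
      (use Suc in \<open>auto simp: frechet_derivative_works\<close>)
qed

lemma Ck_on_bilinear:
  assumes "bounded_bilinear h" "open S" "Ck_on k S f" "Ck_on k S g"
  shows "Ck_on k S (\<lambda>x. h (f x) (g x))"
  using assms(3,4)
proof (induction k arbitrary: f g)
  case 0
  then show ?case
    using bounded_bilinear.continuous_on[OF assms(1)] by simp
next
  case (Suc k)
  show ?case
  proof (rule Ck_on_SucI[OF assms(2) bounded_bilinear.FDERIV[OF assms(1)]])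
    show "(f has_derivative frechet_derivative f (at x)) (at x)" if "x \<in> S" for x
      using Ck_on_Suc_has_derivative Suc.prems(1) that by blast
    show "(g has_derivative frechet_derivative g (at x)) (at x)" if "x \<in> S" for x
      using Ck_on_Suc_has_derivative Suc.prems(2) that by blast
    show "Ck_on k S (\<lambda>x. h (f x) (frechet_derivative g (at x) v) + h (frechet_derivative f (at x) v) (g x))" for v
      using Suc.prems Ck_on_pred[OF Suc.prems(1)] Ck_on_pred[OF Suc.prems(2)]
      by (intro Ck_on_add[OF assms(2)] Suc.IH) simp_all
  qed
qed

lemmas Ck_on_mult = Ck_on_bilinear[OF bounded_bilinear_mult]

lemma Ck_on_sum:
  assumes "open S" "\<And>i. i \<in> I \<Longrightarrow> Ck_on k S (f i)"
  shows "Ck_on k S (\<lambda>x. \<Sum>i\<in>I. f i x)"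
  using assms(2) by (induction I rule: infinite_finite_induct)
    (auto intro: Ck_on_const Ck_on_add assms(1))

lemma Ck_on_diff:
  assumes "open S" "Ck_on k S f" "Ck_on k S g"
  shows "Ck_on k S (\<lambda>x. f x - g x)"
  using Ck_on_add[OF assms(1,2) Ck_on_bounded_linear[OF assms(1) bounded_linear_minus[OF bounded_linear_ident] assms(3)]]
  by simp

text \<open>The functions \<open>exp(-1/t)/t^k\<close>, extended by zero to \<open>t \<le> 0\<close>; this family is closed under
  differentiation up to linear combinations.\<close>

definition flat :: "nat \<Rightarrow> real \<Rightarrow> real" where
  "flat k t = (if t > 0 then exp (- 1 / t) / t ^ k else 0)"

lemma flat_nonneg: "0 \<le> flat k t"
  by (simp add: flat_def)

lemma flat_0_le_1: "flat 0 t \<le> 1"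
  by (simp add: flat_def)

text \<open>A single term of the exponential series of 1/t gives exp(-1/t) <= m! t^m; take m = k +
  2. The quadratic bound makes every function of the family differentiable at 0 with derivative
  0.\<close>

lemma abs_flat_le: "\<bar>flat k t\<bar> \<le> fact (k + 2) * t\<^sup>2"
proof (cases "t > 0")
  case True
  have "(1 / t) ^ m / fact m \<le> exp (1 / t)" for m
  proof -
    have "(\<lambda>n. (1 / t) ^ n /\<^sub>R fact n) sums exp (1 / t)"
      by (rule exp_converges)
    then show ?thesis
      using sum_le_suminf[of "\<lambda>n. (1 / t) ^ n /\<^sub>R fact n" "{m}"] True
      by (auto simp: sums_iff divide_inverse mult.commute)
  qed
  then have le: "exp (- 1 / t) \<le> fact m * t ^ m" for m
    using True by (simp add: exp_minus field_simps power_divide del: fact_Suc power_Suc power_add)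
  have "exp (- 1 / t) / t ^ k \<le> fact (k + 2) * t ^ (k + 2) / t ^ k"
    by (rule divide_right_mono[OF le]) (use True in simp)
  also have "\<dots> = fact (k + 2) * t\<^sup>2"
    using True by (simp add: power_add power2_eq_square del: fact_Suc)
  finally show ?thesis
    using True by (simp add: flat_def)
qed (simp add: flat_def)

text \<open>At t = 0 both terms of the formula vanish, and the difference quotient at h is at most
  (k + 2)! |h|. Away from 0 this is calculus on an open half line.\<close>

lemma has_real_derivative_flat:
  "(flat k has_real_derivative flat (k + 2) t - real k * flat (k + 1) t) (at t)"
proof -
  consider "t > 0" | "t < 0" | "t = 0" by linarith
  then show ?thesis
  proof cases
    case 1
    have "((\<lambda>t. exp (- inverse t) * inverse t ^ k) has_real_derivative
        exp (- inverse t) * inverse t ^ 2 * inverse t ^ k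
          - exp (- inverse t) * (real k * inverse t ^ (k - 1) * inverse t ^ 2)) (at t)"
      using 1 by (auto intro!: derivative_eq_intros simp: power2_eq_square)
    \<comment> \<open>For k = 0 the truncated exponent k - 1 is harmless, since its term carries the
      factor k.\<close>
    also have "exp (- inverse t) * inverse t ^ 2 * inverse t ^ k
          - exp (- inverse t) * (real k * inverse t ^ (k - 1) * inverse t ^ 2)
        = flat (k + 2) t - real k * flat (k + 1) t"
      using 1 by (cases k) (simp_all add: flat_def divide_inverse power_inverse power2_eq_square)
    finally show ?thesis
      by (rule has_field_derivative_transform_within_open[of _ _ _ "{0<..}"])
        (use 1 in \<open>auto simp: flat_def divide_inverse power_inverse\<close>)
  next
    case 2
    have "((\<lambda>t. 0::real) has_real_derivative flat (k + 2) t - real k * flat (k + 1) t) (at t)"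
      using 2 by (auto simp: flat_def)
    then show ?thesis
      by (rule has_field_derivative_transform_within_open[of _ _ _ "{..<0}"])
        (use 2 in \<open>auto simp: flat_def\<close>)
  next
    case 3
    have "((\<lambda>h. flat k h / h) \<longlongrightarrow> 0) (at 0)"
    proof (rule Lim_null_comparison)
      have "norm (flat k h / h) \<le> fact (k + 2) * \<bar>h\<bar>" if "h \<noteq> 0" for h
      proof -
        have "norm (flat k h / h) \<le> fact (k + 2) * h\<^sup>2 / \<bar>h\<bar>"
          using abs_flat_le[of k h] by (simp add: divide_right_mono abs_divide del: fact_Suc)
        also have "\<dots> = fact (k + 2) * \<bar>h\<bar>"
          using that by (simp add: field_simps power2_eq_square del: fact_Suc)
        finally show ?thesis .
      qed
      then show "\<forall>\<^sub>F h in at 0. norm (flat k h / h) \<le> fact (k + 2) * \<bar>h\<bar>"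
        by (simp add: eventually_at_filter del: fact_Suc)
      show "((\<lambda>h. fact (k + 2) * \<bar>h\<bar>) \<longlongrightarrow> (0::real)) (at 0)"
        by (rule tendsto_eq_intros refl | simp)+
    qed
    then show ?thesis
      using 3 by (simp add: DERIV_def flat_def)
  qed
qed

text \<open>Differentiating raises the index k, so the induction on the order m is over the whole
  family at once.\<close>

lemma Ck_on_flat_comp:
  assumes "open S" "\<And>k. Ck_on k S f"
  shows "Ck_on m S (\<lambda>x. flat k (f x))"
proof (induction m arbitrary: k)
  case 0
  have "continuous_on UNIV (flat k)"
    by (rule DERIV_continuous_on[OF has_field_derivative_at_within[OF has_real_derivative_flat]])
  then show ?case
    using assms(2)[of 0] continuous_on_compose2[of UNIV "flat k" S f] by simp
next
  case (Suc m)
  have d: "((\<lambda>x. flat k (f x)) has_derivative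
      (\<lambda>v. (flat (k + 2) (f x) - real k * flat (k + 1) (f x)) * frechet_derivative f (at x) v)) (at x)"
    if "x \<in> S" for x
    using has_derivative_compose[OF Ck_on_Suc_has_derivative[OF assms(2)[of "Suc 0"] that]
        has_real_derivative_flat[of k "f x", unfolded has_field_derivative_def]] by simp
  show ?case
    by (intro Ck_on_SucI[OF assms(1) d] Ck_on_mult Ck_on_diff Suc.IH Ck_on_const assms(1))
      (use assms(2)[of "Suc m"] in auto)
qed

section \<open>Calculus of smooth functions\<close>

lemma smooth_on_imp_continuous_on: "smooth_on S f \<Longrightarrow> continuous_on S f"
  unfolding smooth_on_def using Ck_on.simps(1) by blast

lemma smooth_on_has_derivative:
  "smooth_on S f \<Longrightarrow> x \<in> S \<Longrightarrow> (f has_derivative frechet_derivative f (at x)) (at x)"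
  unfolding smooth_on_def using Ck_on_Suc_has_derivative by blast

lemma smooth_on_derivative: "smooth_on S f \<Longrightarrow> smooth_on S (\<lambda>x. frechet_derivative f (at x) v)"
  unfolding smooth_on_def using Ck_on.simps(2) by blast

lemma smooth_on_const: "open S \<Longrightarrow> smooth_on S (\<lambda>x. c)"
  and smooth_on_add: "open S \<Longrightarrow> smooth_on S f \<Longrightarrow> smooth_on S g \<Longrightarrow> smooth_on S (\<lambda>x. f x + g x)"
  and smooth_on_diff: "open S \<Longrightarrow> smooth_on S f \<Longrightarrow> smooth_on S g \<Longrightarrow> smooth_on S (\<lambda>x. f x - g x)"
  and smooth_on_bounded_linear:
    "open S \<Longrightarrow> bounded_linear h \<Longrightarrow> smooth_on S f \<Longrightarrow> smooth_on S (\<lambda>x. h (f x))"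
  and smooth_on_sum:
    "open S \<Longrightarrow> (\<And>i. i \<in> I \<Longrightarrow> smooth_on S (F i)) \<Longrightarrow> smooth_on S (\<lambda>x. \<Sum>i\<in>I. F i x)"
  and smooth_on_cong:
    "open S \<Longrightarrow> (\<And>x. x \<in> S \<Longrightarrow> f x = g x) \<Longrightarrow> smooth_on S f \<Longrightarrow> smooth_on S g"
  and smooth_on_subset: "smooth_on S f \<Longrightarrow> T \<subseteq> S \<Longrightarrow> smooth_on T f"
  and smooth_on_Un:
    "open S \<Longrightarrow> open T \<Longrightarrow> smooth_on S f \<Longrightarrow> smooth_on T f \<Longrightarrow> smooth_on (S \<union> T) f"
  unfolding smooth_on_def
  by (auto intro: Ck_on_const Ck_on_add Ck_on_diff Ck_on_bounded_linear Ck_on_sum Ck_on_cong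
      Ck_on_subset Ck_on_Un)

lemma smooth_on_mult:
  fixes f g :: "'a::real_normed_vector \<Rightarrow> 'b::real_normed_algebra"
  shows "open S \<Longrightarrow> smooth_on S f \<Longrightarrow> smooth_on S g \<Longrightarrow> smooth_on S (\<lambda>x. f x * g x)"
  unfolding smooth_on_def by (auto intro: Ck_on_mult)

lemma smooth_on_flat_comp: "open S \<Longrightarrow> smooth_on S f \<Longrightarrow> smooth_on S (\<lambda>x. flat k (f x))"
  unfolding smooth_on_def by (auto intro: Ck_on_flat_comp)

section \<open>Holomorphic functions of several variables\<close>

text \<open>Scalar counterpart of \<open>holomorphic_map_on\<close>, meant for components of
  transition maps. Only pointwise complex differentiability is demanded; continuity of the
  derivative has to be proved.\<close>

definition holomorphic_fun_on :: "(complex^'n::finite) set \<Rightarrow> (complex^'n \<Rightarrow> complex) \<Rightarrow> bool" where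
  "holomorphic_fun_on S f \<longleftrightarrow>
     (\<forall>z\<in>S. \<exists>D. (f has_derivative D) (at z) \<and> (\<forall>a v. D (a *s v) = a * D v))"

lemma norm_vector_smult: "norm (a *s v) = norm a * norm (v :: complex^'n::finite)"
  by (simp add: norm_vec_def norm_mult L2_set_right_distrib)

lemma bounded_linear_vector_smult: "bounded_linear (\<lambda>a. a *s (v :: complex^'n::finite))"
  by (intro bounded_linear_intro[where K="norm v"])
    (simp_all add: vec_eq_iff algebra_simps norm_vector_smult)

lemma holomorphic_fun_on_derivative:
  assumes "holomorphic_fun_on S f" "z \<in> S"
  shows "(f has_derivative frechet_derivative f (at z)) (at z)"
    and "frechet_derivative f (at z) (a *s v) = a * frechet_derivative f (at z) v"
proof -
  obtain D where D: "(f has_derivative D) (at z)" "\<forall>a v. D (a *s v) = a * D v"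
    using assms unfolding holomorphic_fun_on_def by auto
  then show "(f has_derivative frechet_derivative f (at z)) (at z)"
    and "frechet_derivative f (at z) (a *s v) = a * frechet_derivative f (at z) v"
    by (simp_all flip: frechet_derivative_at)
qed

lemma continuous_on_holomorphic: "holomorphic_fun_on S f \<Longrightarrow> continuous_on S f"
  by (meson continuous_at_imp_continuous_on has_derivative_continuous holomorphic_fun_on_derivative(1))

text \<open>Cauchy's formula for the first derivative, applied to the restriction of f to the
  complex line through z in direction v. In this form z enters the integrand only through the
  argument of f, which prepares differentiation under the integral.\<close>

lemma Cauchy_directional_derivative:
  fixes f :: "complex^'n::finite \<Rightarrow> complex"
  assumes f: "holomorphic_fun_on S f" and "0 < r"
    and S: "\<And>\<zeta>. norm \<zeta> \<le> r \<Longrightarrow> z + \<zeta> *s v \<in> S"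
  shows "frechet_derivative f (at z) v
    = integral (cbox 0 1) (\<lambda>t. f (z + circlepath 0 r t *s v) / circlepath 0 r t)"
proof -
  define h where "h \<zeta> = f (z + \<zeta> *s v)" for \<zeta>
  have der: "(h has_field_derivative frechet_derivative f (at (z + \<zeta> *s v)) v) (at \<zeta>)" if "norm \<zeta> \<le> r" for \<zeta>
  proof -
    have "((\<lambda>\<zeta>. z + \<zeta> *s v) has_derivative (\<lambda>a. 0 + a *s v)) (at \<zeta>)"
      by (intro has_derivative_add has_derivative_const
          bounded_linear_imp_has_derivative bounded_linear_vector_smult)
    from has_derivative_compose[OF this holomorphic_fun_on_derivative(1)[OF f S[OF that]]]
    show ?thesis
      unfolding has_field_derivative_def h_def
      by (simp add: holomorphic_fun_on_derivative(2)[OF f S[OF that]] mult.commute[of _ "frechet_derivative _ _ _"])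
  qed
  have cont: "continuous_on (cball 0 r) h"
    by (rule continuous_at_imp_continuous_on) (use DERIV_isCont[OF der] in auto)
  have hol: "h holomorphic_on ball 0 r"
    by (rule holomorphic_onI)
      (meson der field_differentiable_def field_differentiable_at_within less_imp_le mem_ball_0)
  have "(h has_field_derivative 1 / (2 * of_real pi * \<i>)
      * contour_integral (circlepath 0 r) (\<lambda>u. h u / (u - 0)^2)) (at 0)"
    by (rule Cauchy_derivative_integral_circlepath(2)[OF cont hol]) (use \<open>0 < r\<close> in simp)
  moreover have "(h has_field_derivative frechet_derivative f (at z) v) (at 0)"
    using der[of 0] \<open>0 < r\<close> by simp
  ultimately have "frechet_derivative f (at z) v
      = 1 / (2 * of_real pi * \<i>) * contour_integral (circlepath 0 r) (\<lambda>u. h u / (u - 0)^2)"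
    by (rule DERIV_unique[rotated])
  also have "\<dots> = integral {0..1} (\<lambda>t. 1 / (2 * of_real pi * \<i>) *
      (h (circlepath 0 r t) / (circlepath 0 r t)\<^sup>2 * vector_derivative (circlepath 0 r) (at t)))"
    by (simp only: contour_integral_integral integral_mult_right diff_zero)
  \<comment> \<open>On the circle u' = 2 pi i u, which cancels the prefactor and one power of
    u.\<close>
  also have "\<dots> = integral {0..1} (\<lambda>t. h (circlepath 0 r t) / circlepath 0 r t)"
    by (rule integral_cong, unfold vector_derivative_circlepath)
      (use \<open>0 < r\<close> in \<open>simp add: circlepath power2_eq_square field_simps\<close>)
  finally show ?thesis
    by (simp add: h_def)
qed

text \<open>Provides one circle that serves all centres z near z0, so that the path of integration
  stays fixed while z varies.\<close>

lemma open_smult_neighbourhood: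
  fixes v :: "complex^'n::finite"
  assumes "open S" "z0 \<in> S"
  shows "\<exists>\<delta>>0. \<exists>r>0. \<forall>z\<in>ball z0 \<delta>. \<forall>\<zeta>. norm \<zeta> \<le> r \<longrightarrow> z + \<zeta> *s v \<in> S"
proof -
  obtain e where e: "0 < e" "ball z0 e \<subseteq> S"
    using assms open_contains_ball by blast
  \<comment> \<open>The + 1 covers v = 0.\<close>
  define r where "r = e / 2 / (norm v + 1)"
  have r: "0 < r"
    unfolding r_def using e(1) by (intro divide_pos_pos add_nonneg_pos) auto
  have "z + \<zeta> *s v \<in> S" if "z \<in> ball z0 (e / 2)" "norm \<zeta> \<le> r" for z \<zeta>
  proof -
    have "norm (\<zeta> *s v) \<le> r * (norm v + 1)"
      using that(2) r by (auto simp: norm_vector_smult intro: mult_mono)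
    also have "\<dots> = e / 2"
      unfolding r_def using norm_ge_zero[of v] by (simp add: field_simps add_nonneg_eq_0_iff)
    finally have "norm (\<zeta> *s v) \<le> e / 2" .
    then have "dist z0 (z + \<zeta> *s v) < e"
      using that(1) norm_triangle_ineq4[of "z0 - z" "\<zeta> *s v"]
      by (simp add: dist_norm algebra_simps)
    then show ?thesis
      using e(2) by auto
  qed
  then show ?thesis
    using e(1) r by (intro exI[of _ "e / 2"] conjI exI[of _ r]) auto
qed

lemma circlepath_0_props:
  assumes "0 < r"
  shows "norm (circlepath 0 r t) = r" "circlepath 0 r t \<noteq> 0"
  using assms by (auto simp: circlepath norm_mult)

lemma continuous_on_circlepath: "continuous_on A h \<Longrightarrow> continuous_on A (\<lambda>p. circlepath 0 r (h p))"
  unfolding circlepath by (intro continuous_intros)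

text \<open>Cauchy's formula writes the derivative as a parameter integral with jointly continuous
  integrand. The next lemma differentiates that integral once more, and the Leibniz rule asks for
  precisely this continuity.\<close>

lemma continuous_on_holomorphic_derivative:
  fixes f :: "complex^'n::finite \<Rightarrow> complex"
  assumes "open S" and f: "holomorphic_fun_on S f"
  shows "continuous_on S (\<lambda>z. frechet_derivative f (at z) v)"
proof (rule continuous_at_imp_continuous_on, rule ballI)
  fix z0 assume z0: "z0 \<in> S"
  obtain \<delta> r where d: "0 < \<delta>" "0 < r"
    "\<forall>z\<in>ball z0 \<delta>. \<forall>\<zeta>. norm \<zeta> \<le> r \<longrightarrow> z + \<zeta> *s v \<in> S"
    using open_smult_neighbourhood[OF assms(1) z0, of v] by (elim exE conjE)
  then have *: "0 < \<delta>" "0 < r"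
    "\<And>z \<zeta>. z \<in> ball z0 \<delta> \<Longrightarrow> norm \<zeta> \<le> r \<Longrightarrow> z + \<zeta> *s v \<in> S"
    by simp_all
  note contf = continuous_on_holomorphic[OF f]
  have "continuous_on (ball z0 \<delta>)
      (\<lambda>z. integral (cbox 0 1) (\<lambda>t. f (z + circlepath 0 r t *s v) / circlepath 0 r t))"
  proof (rule integral_continuous_on_param)
    have "continuous_on (ball z0 \<delta> \<times> cbox 0 1) (\<lambda>p. circlepath 0 r (snd p))"
      by (intro continuous_on_circlepath continuous_on_snd continuous_on_id)
    then show "continuous_on (ball z0 \<delta> \<times> cbox 0 1)
        (\<lambda>(z, t). f (z + circlepath 0 r t *s v) / circlepath 0 r t)"
      unfolding case_prod_beta
      using *(3) circlepath_0_props[OF *(2)]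
      by (intro continuous_on_divide continuous_on_compose2[OF contf] continuous_on_add
          bounded_linear.continuous_on[OF bounded_linear_vector_smult] continuous_intros) auto
  qed
  then have "continuous_on (ball z0 \<delta>) (\<lambda>z. frechet_derivative f (at z) v)"
    by (rule continuous_on_eq)
      (use Cauchy_directional_derivative[OF f *(2)] *(3) in \<open>simp del: cbox_interval\<close>)
  then show "isCont (\<lambda>z. frechet_derivative f (at z) v) z0"
    using *(1) by (simp add: continuous_on_eq_continuous_at)
qed

text \<open>Differentiation of Cauchy's formula for the directional derivative under the integral sign.\<close>

lemma holomorphic_fun_on_frechet_derivative:
  fixes f :: "complex^'n::finite \<Rightarrow> complex"
  assumes "open S" and f: "holomorphic_fun_on S f"
  shows "holomorphic_fun_on S (\<lambda>z. frechet_derivative f (at z) v)"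
  unfolding holomorphic_fun_on_def
proof
  fix z0 assume z0: "z0 \<in> S"
  obtain \<delta> r where d: "0 < \<delta>" "0 < r"
    "\<forall>z\<in>ball z0 \<delta>. \<forall>\<zeta>. norm \<zeta> \<le> r \<longrightarrow> z + \<zeta> *s v \<in> S"
    using open_smult_neighbourhood[OF assms(1) z0, of v] by (elim exE conjE)
  then have *: "0 < \<delta>" "0 < r"
    "\<And>z \<zeta>. z \<in> ball z0 \<delta> \<Longrightarrow> norm \<zeta> \<le> r \<Longrightarrow> z + \<zeta> *s v \<in> S"
    by simp_all
  define e where "e = circlepath 0 r"
  have e: "norm (e t) = r" "e t \<noteq> 0" for t
    unfolding e_def by (simp_all add: circlepath_0_props[OF *(2)])
  have inS: "z + e t *s v \<in> S" if "z \<in> ball z0 \<delta>" for z t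
    using *(3) that e(1) by simp
  \<comment> \<open>The derivative of the integrand in z, packaged as a bounded linear map as the
    Leibniz rule requires. Its continuity may be checked on each vector w separately, because the
    domain is finite-dimensional.\<close>
  define F where "F z t = Blinfun (\<lambda>w. frechet_derivative f (at (z + e t *s v)) w / e t)" for z t
  have F: "blinfun_apply (F z t) = (\<lambda>w. frechet_derivative f (at (z + e t *s v)) w / e t)"
    if "z \<in> ball z0 \<delta>" for z t
    unfolding F_def
    by (rule bounded_linear_Blinfun_apply, rule bounded_linear_compose[OF bounded_linear_divide])
      (use holomorphic_fun_on_derivative(1)[OF f inS[OF that]] has_derivative_bounded_linear in blast)
  have conte: "continuous_on (ball z0 \<delta> \<times> cbox (0::real) 1) (\<lambda>p. e (snd p))"
    unfolding e_def by (intro continuous_on_circlepath continuous_on_snd continuous_on_id)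
  have conte': "continuous_on (cbox 0 1) e"
    unfolding e_def by (intro continuous_on_circlepath continuous_on_id)
  note contf = continuous_on_holomorphic[OF f]
  have contF: "continuous_on (ball z0 \<delta> \<times> cbox 0 1) (\<lambda>(z, t). F z t)"
  proof -
    have "continuous_on (ball z0 \<delta> \<times> cbox 0 1) (\<lambda>p. blinfun_apply (F (fst p) (snd p)) w)" for w
    proof (rule continuous_on_eq)
      show "continuous_on (ball z0 \<delta> \<times> cbox 0 1)
          (\<lambda>p. frechet_derivative f (at (fst p + e (snd p) *s v)) w / e (snd p))"
        using inS e(2)
        by (intro continuous_on_divide conte
            continuous_on_compose2[OF continuous_on_holomorphic_derivative[OF assms]] continuous_on_add
            bounded_linear.continuous_on[OF bounded_linear_vector_smult] continuous_intros) auto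
    qed (auto simp: F)
    then show ?thesis
      unfolding continuous_on_eq_continuous_within case_prod_beta
      by (auto intro!: continuous_blinfun_componentwiseI1)
  qed
  have "((\<lambda>z. integral (cbox 0 1) (\<lambda>t. f (z + e t *s v) / e t)) has_derivative
      integral (cbox 0 1) (F z0)) (at z0 within ball z0 \<delta>)"
  proof (rule leibniz_rule)
    fix z t assume z: "z \<in> ball z0 \<delta>"
    have "((\<lambda>z. z + e t *s v) has_derivative (\<lambda>w. w)) (at z)"
      by (auto intro!: derivative_eq_intros)
    from bounded_linear.has_derivative[OF bounded_linear_divide
        has_derivative_compose[OF this, of f, OF holomorphic_fun_on_derivative(1)[OF f inS[OF z]]]]
    have "((\<lambda>z. f (z + e t *s v) / e t) has_derivative
        (\<lambda>w. frechet_derivative f (at (z + e t *s v)) w / e t)) (at z)" .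
    then show "((\<lambda>z. f (z + e t *s v) / e t) has_derivative blinfun_apply (F z t)) (at z within ball z0 \<delta>)"
      unfolding F[OF z] by (rule has_derivative_at_withinI)
  next
    fix z assume z: "z \<in> ball z0 \<delta>"
    show "(\<lambda>t. f (z + e t *s v) / e t) integrable_on cbox 0 1"
      using inS[OF z] e(2) conte'
      by (intro integrable_continuous continuous_on_divide continuous_on_compose2[OF contf] continuous_on_add
          bounded_linear.continuous_on[OF bounded_linear_vector_smult] continuous_on_const) auto
  qed (use contF *(1) in auto)
  then have D: "((\<lambda>z. integral (cbox 0 1) (\<lambda>t. f (z + e t *s v) / e t)) has_derivative
      integral (cbox 0 1) (F z0)) (at z0)"
    using at_within_open[of z0 "ball z0 \<delta>"] *(1) by (simp only: centre_in_ball open_ball)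
  have "((\<lambda>z. frechet_derivative f (at z) v) has_derivative integral (cbox 0 1) (F z0)) (at z0)"
    by (rule has_derivative_transform_within_open[OF D, of "ball z0 \<delta>"])
      (use *(1) in \<open>simp_all only: open_ball centre_in_ball e_def
          Cauchy_directional_derivative[OF f *(2,3)]\<close>)
  \<comment> \<open>Each F z0 t commutes with complex scalars, and this survives integration over
    t.\<close>
  moreover have "blinfun_apply (integral (cbox 0 1) (F z0)) (a *s w)
      = a * blinfun_apply (integral (cbox 0 1) (F z0)) w" for a w
  proof -
    have z0': "z0 \<in> ball z0 \<delta>"
      using *(1) by simp
    have "continuous_on (cbox 0 1) (F z0)"
      using continuous_on_compose2[OF contF, of "cbox 0 1" "\<lambda>t. (z0, t)"] *(1)
      by (fastforce intro: continuous_on_Pair continuous_on_const continuous_on_id)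
    then have "F z0 integrable_on cbox 0 1"
      by (rule integrable_continuous)
    then show ?thesis
      by (simp add: blinfun_apply_integral F[OF z0'] holomorphic_fun_on_derivative(2)[OF f inS[OF z0']]
          del: cbox_interval flip: integral_mult_right)
  qed
  ultimately show "\<exists>D. ((\<lambda>z. frechet_derivative f (at z) v) has_derivative D) (at z0) \<and>
      (\<forall>a w. D (a *s w) = a * D w)"
    by blast
qed

text \<open>Directional derivatives are again holomorphic, so holomorphy itself carries the
  induction over the order.\<close>

lemma smooth_on_holomorphic:
  assumes "open S" "holomorphic_fun_on S f"
  shows "smooth_on S f"
proof -
  have "Ck_on k S f" for k
    using assms(2)
  proof (induction k arbitrary: f)
    case 0
    then show ?case
      by (simp add: continuous_on_holomorphic)
  next
    case (Suc k)
    show ?case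
      by (rule Ck_on_SucI[OF assms(1) holomorphic_fun_on_derivative(1)[OF Suc.prems]])
        (auto intro: Suc.IH holomorphic_fun_on_frechet_derivative assms(1) Suc.prems)
  qed
  then show ?thesis
    by (simp add: smooth_on_def)
qed

section \<open>Wirtinger derivatives and the Levi form\<close>

lemma dz_eq: "(f has_derivative D) (at z) \<Longrightarrow> dz i f z = (D (axis i 1) - \<i> * D (axis i \<i>)) / 2"
  and dzbar_eq: "(f has_derivative D) (at z) \<Longrightarrow> dzbar i f z = (D (axis i 1) + \<i> * D (axis i \<i>)) / 2"
  by (simp_all add: dz_def dzbar_def flip: frechet_derivative_at)

lemma dz_cong:
  assumes "open S" "z \<in> S" "\<And>z. z \<in> S \<Longrightarrow> f z = g z"
  shows "dz i f z = dz i g z" and "dzbar i f z = dzbar i g z"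
proof -
  have "(f has_derivative D) (at z) \<longleftrightarrow> (g has_derivative D) (at z)" for D
    using has_derivative_transform_within_open[OF _ assms(1,2), of f D UNIV g]
      has_derivative_transform_within_open[OF _ assms(1,2), of g D UNIV f] assms(3) by auto
  then have "frechet_derivative f (at z) = frechet_derivative g (at z)"
    unfolding frechet_derivative_def by simp
  then show "dz i f z = dz i g z" and "dzbar i f z = dzbar i g z"
    by (simp_all add: dz_def dzbar_def)
qed

lemma
  assumes "f differentiable (at z)" "g differentiable (at z)"
  shows dz_add: "dz i (\<lambda>z. f z + g z) z = dz i f z + dz i g z"
    and dzbar_add: "dzbar i (\<lambda>z. f z + g z) z = dzbar i f z + dzbar i g z"
    and dz_mult: "dz i (\<lambda>z. f z * g z) z = dz i f z * g z + f z * dz i g z"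
    and dzbar_mult: "dzbar i (\<lambda>z. f z * g z) z = dzbar i f z * g z + f z * dzbar i g z"
proof -
  note f = assms(1)[unfolded frechet_derivative_works] and g = assms(2)[unfolded frechet_derivative_works]
  show "dz i (\<lambda>z. f z + g z) z = dz i f z + dz i g z"
    "dzbar i (\<lambda>z. f z + g z) z = dzbar i f z + dzbar i g z"
    unfolding dz_eq[OF has_derivative_add[OF f g]] dzbar_eq[OF has_derivative_add[OF f g]]
    by (simp_all add: dz_def dzbar_def field_simps)
  show "dz i (\<lambda>z. f z * g z) z = dz i f z * g z + f z * dz i g z"
    "dzbar i (\<lambda>z. f z * g z) z = dzbar i f z * g z + f z * dzbar i g z"
    unfolding dz_eq[OF has_derivative_mult[OF f g]] dzbar_eq[OF has_derivative_mult[OF f g]]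
    by (simp_all add: dz_def dzbar_def field_simps)
qed

lemma dz_const [simp]: "dz i (\<lambda>z. c) z = 0"
  and dzbar_const [simp]: "dzbar i (\<lambda>z. c) z = 0"
  by (simp_all add: dz_def dzbar_def)

lemma
  assumes "f differentiable (at z)"
  shows dz_cmult: "dz i (\<lambda>z. c * f z) z = c * dz i f z"
    and dzbar_cmult: "dzbar i (\<lambda>z. c * f z) z = c * dzbar i f z"
  using dz_mult[OF differentiable_const assms, of i c] dzbar_mult[OF differentiable_const assms, of i c]
  by simp_all

lemma
  assumes "finite I" "\<And>k. k \<in> I \<Longrightarrow> f k differentiable (at z)"
  shows dz_sum: "dz i (\<lambda>z. \<Sum>k\<in>I. f k z) z = (\<Sum>k\<in>I. dz i (f k) z)"
    and dzbar_sum: "dzbar i (\<lambda>z. \<Sum>k\<in>I. f k z) z = (\<Sum>k\<in>I. dzbar i (f k) z)"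
  using assms
  by (induction I rule: finite_induct) (auto simp: dz_add dzbar_add)

lemma
  assumes "f differentiable (at z)"
  shows dz_cnj: "dz i (\<lambda>z. cnj (f z)) z = cnj (dzbar i f z)"
    and dzbar_cnj: "dzbar i (\<lambda>z. cnj (f z)) z = cnj (dz i f z)"
proof -
  note f = has_derivative_cnj[OF assms[unfolded frechet_derivative_works]]
  show "dz i (\<lambda>z. cnj (f z)) z = cnj (dzbar i f z)" "dzbar i (\<lambda>z. cnj (f z)) z = cnj (dz i f z)"
    unfolding dz_eq[OF f] dzbar_eq[OF f] by (simp_all add: dz_def dzbar_def)
qed

lemma axis_imaginary: "axis i \<i> = \<i> *s (axis i 1 :: complex^'n::finite)"
  by (simp add: vec_eq_iff axis_def)

lemma
  assumes "holomorphic_fun_on S f" "z \<in> S"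
  shows dz_holomorphic: "dz i f z = frechet_derivative f (at z) (axis i 1)"
    and dzbar_holomorphic: "dzbar i f z = 0"
  by (simp_all add: dz_def dzbar_def axis_imaginary holomorphic_fun_on_derivative(2)[OF assms])

lemma smooth_on_differentiable: "smooth_on S f \<Longrightarrow> z \<in> S \<Longrightarrow> f differentiable (at z)"
  by (rule differentiableI[OF smooth_on_has_derivative])

lemma smooth_on_dz: "open S \<Longrightarrow> smooth_on S f \<Longrightarrow> smooth_on S (dz i f)"
  unfolding dz_def[abs_def] divide_inverse
  by (intro smooth_on_mult smooth_on_diff smooth_on_const smooth_on_derivative; assumption)+

definition second_derivative :: "('a::real_normed_vector \<Rightarrow> real) \<Rightarrow> 'a \<Rightarrow> 'a \<Rightarrow> 'a \<Rightarrow> real" where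
  "second_derivative f z v w = frechet_derivative (\<lambda>z. frechet_derivative f (at z) v) (at z) w"

lemma has_derivative_frechet_derivative:
  assumes "smooth_on S f" "z \<in> S"
  shows "((\<lambda>z. frechet_derivative f (at z) v) has_derivative second_derivative f z v) (at z)"
  using smooth_on_has_derivative[OF smooth_on_derivative[OF assms(1)] assms(2)]
  by (simp add: second_derivative_def[abs_def])

text \<open>Linearity in w is that of a derivative. For v, the linearity of
  \<open>frechet_derivative f (at y)\<close> holds at all y near z and can be differentiated in
  y.\<close>

lemma bilinear_second_derivative:
  assumes "open S" "smooth_on S f" "z \<in> S"
  shows "bilinear (second_derivative f z)"
  unfolding bilinear_def
proof (intro conjI allI)
  note d = has_derivative_frechet_derivative[OF assms(2,3)]
  show "linear (second_derivative f z v)" for v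
    using has_derivative_bounded_linear[OF d] by (rule bounded_linear.linear)
  have lin: "linear (frechet_derivative f (at y))" if "y \<in> S" for y
    using has_derivative_bounded_linear[OF smooth_on_has_derivative[OF assms(2) that]]
    by (rule bounded_linear.linear)
  have eqI: "second_derivative f z v = D"
    if D: "((\<lambda>y. g y) has_derivative D) (at z)"
      and g: "\<And>y. y \<in> S \<Longrightarrow> g y = frechet_derivative f (at y) v" for v D g
    using has_derivative_unique[OF d[of v] has_derivative_transform_within_open[OF D assms(1,3) g]] by simp
  show "linear (\<lambda>v. second_derivative f z v w)" for w
  proof (rule linearI)
    fix v v' :: 'a and c :: real
    have "second_derivative f z (v + v') = (\<lambda>w. second_derivative f z v w + second_derivative f z v' w)"
      by (rule eqI[OF has_derivative_add[OF d d]]) (simp add: linear_add[OF lin])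
    then show "second_derivative f z (v + v') w = second_derivative f z v w + second_derivative f z v' w"
      by simp
    have "second_derivative f z (c *\<^sub>R v) = (\<lambda>w. c *\<^sub>R second_derivative f z v w)"
      by (rule eqI[OF has_derivative_scaleR_right[OF d]]) (simp add: linear_scale[OF lin])
    then show "second_derivative f z (c *\<^sub>R v) w = c *\<^sub>R second_derivative f z v w"
      by simp
  qed
qed

text \<open>Restrict f to the real line through z in direction v. If the second derivative were
  positive, the first one, which vanishes at 0, would be positive just after 0, and by the mean
  value theorem f would exceed its maximum.\<close>

lemma second_derivative_nonpos_at_max:
  assumes "open S" "smooth_on S f" "z \<in> S" "\<And>y. y \<in> S \<Longrightarrow> f y \<le> f z"
  shows "second_derivative f z v v \<le> 0"
proof (rule ccontr)
  assume "\<not> ?thesis"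
  then have pos: "0 < second_derivative f z v v" by simp
  define g where "g t = f (z + t *\<^sub>R v)" for t
  define h where "h t = frechet_derivative f (at (z + t *\<^sub>R v)) v" for t
  have line: "((\<lambda>t. z + t *\<^sub>R v) has_derivative (\<lambda>t. t *\<^sub>R v)) (at t)" for t
    by (auto intro!: derivative_eq_intros)
  have "open ((\<lambda>t. z + t *\<^sub>R v) -` S)"
    by (intro open_vimage assms(1) continuous_intros)
  then obtain e where e: "0 < e" "\<And>t. \<bar>t\<bar> < e \<Longrightarrow> z + t *\<^sub>R v \<in> S"
    using assms(3) unfolding open_dist by (force simp: dist_norm dest: bspec[where x=0])
  have g: "(g has_real_derivative h t) (at t)" if "\<bar>t\<bar> < e" for t
  proof -
    note * = smooth_on_has_derivative[OF assms(2) e(2)[OF that]]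
    have "(g has_derivative (\<lambda>s. frechet_derivative f (at (z + t *\<^sub>R v)) (s *\<^sub>R v))) (at t)"
      unfolding g_def by (rule has_derivative_compose[OF line *])
    then show ?thesis
      using linear_scale[OF bounded_linear.linear[OF has_derivative_bounded_linear[OF *]]]
      by (simp add: has_field_derivative_def h_def mult_commute_abs)
  qed
  have h: "(h has_real_derivative second_derivative f z v v) (at 0)"
  proof -
    note * = has_derivative_frechet_derivative[OF assms(2,3), of v]
    have "(h has_derivative (\<lambda>s. second_derivative f z v (s *\<^sub>R v))) (at 0)"
      unfolding h_def using has_derivative_compose[OF line[of 0], of "\<lambda>y. frechet_derivative f (at y) v"] * by simp
    then show ?thesis
      using linear_scale[OF bounded_linear.linear[OF has_derivative_bounded_linear[OF *]]]
      by (simp add: has_field_derivative_def mult_commute_abs)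
  qed
  have "h 0 = 0"
  proof (rule DERIV_local_max[OF _ e(1)])
    show "(g has_real_derivative h 0) (at 0)" using g[of 0] e(1) by simp
    show "\<forall>t. \<bar>0 - t\<bar> < e \<longrightarrow> g t \<le> g 0"
      using e(2) assms(4) by (simp add: g_def)
  qed
  then obtain d where d: "0 < d" "\<And>t. 0 < t \<Longrightarrow> t < d \<Longrightarrow> 0 < h t"
    using DERIV_pos_inc_right[OF h pos] by auto
  define t where "t = min d e / 2"
  have t: "0 < t" "t < d" "t < e"
    using d(1) e(1) by (auto simp: t_def min_def)
  have "\<exists>s. 0 < s \<and> s < t \<and> g t - g 0 = (t - 0) * h s"
    by (rule MVT2[OF t(1)]) (use g t in auto)
  then obtain s where s: "0 < s" "s < t" "g t - g 0 = t * h s"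
    by auto
  then have "0 < t * h s"
    using d(2)[of s] t by simp
  with s(3) have "g 0 < g t"
    by simp
  then show False
    using assms(4)[OF e(2)[of t]] t by (simp add: g_def)
qed

text \<open>The complex Hessian, with the derivatives in the order in which curvature produces them:
  \<open>dz\<close> in the connection, then \<open>dzbar\<close>.\<close>

definition levi :: "(complex^'n::finite \<Rightarrow> real) \<Rightarrow> complex^'n \<Rightarrow> 'n \<Rightarrow> 'n \<Rightarrow> complex" where
  "levi f z i j = dzbar j (dz i (\<lambda>z. complex_of_real (f z))) z"

lemma smooth_on_of_real: "open S \<Longrightarrow> smooth_on S f \<Longrightarrow> smooth_on S (\<lambda>z. complex_of_real (f z))"
  by (rule smooth_on_bounded_linear[OF _ bounded_linear_of_real])

lemma levi_linear:
  assumes "open S" "smooth_on S f" "smooth_on S g" "z \<in> S"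
  shows "levi (\<lambda>z. a * f z + b * g z) z i j = a * levi f z i j + b * levi g z i j"
proof -
  note f = smooth_on_of_real[OF assms(1,2)] and g = smooth_on_of_real[OF assms(1,3)]
  note d = smooth_on_differentiable[OF f] smooth_on_differentiable[OF g]
    smooth_on_differentiable[OF smooth_on_dz[OF assms(1) f]]
    smooth_on_differentiable[OF smooth_on_dz[OF assms(1) g]]
    differentiable_mult[OF differentiable_const]
  have "levi (\<lambda>z. a * f z + b * g z) z i j
      = dzbar j (\<lambda>z. a * dz i (\<lambda>z. complex_of_real (f z)) z + b * dz i (\<lambda>z. complex_of_real (g z)) z) z"
    unfolding levi_def
    by (rule dz_cong[OF assms(1,4)]) (simp add: dz_add dz_cmult d)
  also have "\<dots> = a * levi f z i j + b * levi g z i j"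
    by (simp add: dzbar_add dzbar_cmult d assms(4) levi_def)
  finally show ?thesis .
qed

lemma levi_eq:
  assumes "open S" "smooth_on S f" "z \<in> S"
  shows "levi f z i j =
    (second_derivative f z (axis i 1) (axis j 1) + second_derivative f z (axis i \<i>) (axis j \<i>)
     + \<i> * (second_derivative f z (axis i 1) (axis j \<i>) - second_derivative f z (axis i \<i>) (axis j 1))) / 4"
proof -
  have 1: "dz i (\<lambda>z. complex_of_real (f z)) y
      = (of_real (frechet_derivative f (at y) (axis i 1)) - \<i> * of_real (frechet_derivative f (at y) (axis i \<i>))) / 2"
    if "y \<in> S" for y
    by (rule dz_eq[OF has_derivative_of_real[OF smooth_on_has_derivative[OF assms(2) that]]])
  have 2: "((\<lambda>y. (of_real (frechet_derivative f (at y) (axis i 1))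
        - \<i> * of_real (frechet_derivative f (at y) (axis i \<i>))) / 2) has_derivative
      (\<lambda>w. (complex_of_real (second_derivative f z (axis i 1) w)
        - \<i> * of_real (second_derivative f z (axis i \<i>) w)) / 2)) (at z)"
    by (intro bounded_linear.has_derivative[OF bounded_linear_divide] has_derivative_diff
        has_derivative_of_real has_derivative_mult_right has_derivative_frechet_derivative[OF assms(2,3)])
  have "levi f z i j = dzbar j (\<lambda>y. (of_real (frechet_derivative f (at y) (axis i 1))
        - \<i> * of_real (frechet_derivative f (at y) (axis i \<i>))) / 2) z"
    unfolding levi_def by (rule dz_cong[OF assms(1,3) 1])
  then show ?thesis
    unfolding dzbar_eq[OF 2] by (simp add: complex_eq_iff field_simps)
qed

lemma vec_eq_sum_axis:
  "(a :: complex^'n::finite) = (\<Sum>i\<in>UNIV. Re (a $ i) *\<^sub>R axis i 1 + Im (a $ i) *\<^sub>R axis i \<i>)"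
  by (simp add: vec_eq_iff axis_def complex_eq_iff if_distrib[of Re] if_distrib[of Im]
      if_distrib[of "(*) _"] cong: if_cong)

text \<open>Reduces the sign of the Levi form on a to the real Hessian on the two real directions a
  and i a of the complex line spanned by a. The identity holds separately for each pair (i, j) of
  coordinates.\<close>

lemma Re_levi_form:
  assumes "open S" "smooth_on S f" "z \<in> S"
  shows "Re (\<Sum>i\<in>UNIV. \<Sum>j\<in>UNIV. a $ i * cnj (a $ j) * levi f z i j) =
    (second_derivative f z a a + second_derivative f z (\<i> *s a) (\<i> *s a)) / 4"
proof -
  define B where "B = second_derivative f z"
  have B: "bilinear B"
    unfolding B_def by (rule bilinear_second_derivative[OF assms])
  note bil = bilinear_ladd[OF B] bilinear_radd[OF B] bilinear_lmul[OF B] bilinear_rmul[OF B]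
  have exp: "B v v = (\<Sum>i\<in>UNIV. \<Sum>j\<in>UNIV.
      Re (v $ i) * Re (v $ j) * B (axis i 1) (axis j 1) + Re (v $ i) * Im (v $ j) * B (axis i 1) (axis j \<i>)
      + Im (v $ i) * Re (v $ j) * B (axis i \<i>) (axis j 1) + Im (v $ i) * Im (v $ j) * B (axis i \<i>) (axis j \<i>))"
    for v
  proof -
    have "B v v = B (\<Sum>i\<in>UNIV. Re (v $ i) *\<^sub>R axis i 1 + Im (v $ i) *\<^sub>R axis i \<i>)
        (\<Sum>i\<in>UNIV. Re (v $ i) *\<^sub>R axis i 1 + Im (v $ i) *\<^sub>R axis i \<i>)"
      by (simp flip: vec_eq_sum_axis)
    also have "\<dots> = (\<Sum>(i, j)\<in>UNIV \<times> UNIV. B (Re (v $ i) *\<^sub>R axis i 1 + Im (v $ i) *\<^sub>R axis i \<i>)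
        (Re (v $ j) *\<^sub>R axis j 1 + Im (v $ j) *\<^sub>R axis j \<i>))"
      by (rule bilinear_sum[OF B])
    finally show ?thesis
      unfolding bil by (simp add: sum.cartesian_product algebra_simps)
  qed
  show ?thesis
    unfolding B_def[symmetric] exp levi_eq[OF assms] sum.distrib[symmetric] sum_divide_distrib Re_sum
    by (intro sum.cong refl) (simp add: field_simps)
qed

lemma levi_form_nonpos_at_max:
  assumes "open S" "smooth_on S f" "z \<in> S" "\<And>y. y \<in> S \<Longrightarrow> f y \<le> f z"
  shows "Re (\<Sum>i\<in>UNIV. \<Sum>j\<in>UNIV. a $ i * cnj (a $ j) * levi f z i j) \<le> 0"
  unfolding Re_levi_form[OF assms(1-3)]
  using second_derivative_nonpos_at_max[OF assms, of a] second_derivative_nonpos_at_max[OF assms, of "\<i> *s a"]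
  by simp

section \<open>Positive definite Hermitian matrices\<close>

definition hermitian_posdef :: "complex^'n::finite^'n \<Rightarrow> bool" where
  "hermitian_posdef H \<longleftrightarrow> (\<forall>i j. H $ j $ i = cnj (H $ i $ j)) \<and>
     (\<forall>v. v \<noteq> 0 \<longrightarrow> 0 < Re (\<Sum>i\<in>UNIV. \<Sum>j\<in>UNIV. H $ i $ j * v $ i * cnj (v $ j)))"

lemma hermitian_posdefD:
  assumes "hermitian_posdef H"
  shows "cnj (H $ i $ j) = H $ j $ i"
    and "v \<noteq> 0 \<Longrightarrow> 0 < Re (\<Sum>i\<in>UNIV. \<Sum>j\<in>UNIV. H $ i $ j * v $ i * cnj (v $ j))"
  using assms[unfolded hermitian_posdef_def, THEN conjunct1, rule_format, of i j]
    assms[unfolded hermitian_posdef_def, THEN conjunct2, rule_format, of v] by auto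

lemma matrix_inv_props:
  assumes "invertible A"
  shows "A ** matrix_inv A = mat 1" "matrix_inv A ** A = mat 1"
  using someI_ex[OF assms[unfolded invertible_def]] unfolding matrix_inv_def by auto

lemma matrix_mult_mat1_component:
  assumes "A ** B = mat 1"
  shows "(\<Sum>k\<in>UNIV. A $ i $ k * B $ k $ j) = (if i = j then 1 else 0)"
  using arg_cong[OF assms, of "\<lambda>M. M $ i $ j"] by (simp add: matrix_matrix_mult_def mat_def)

lemma hermitian_posdef_invertible:
  fixes H :: "complex^'n::finite^'n"
  assumes "hermitian_posdef H"
  shows "invertible H"
proof -
  have "x = 0" if "H *v x = 0" for x
  proof (rule ccontr)
    assume "x \<noteq> 0"
    \<comment> \<open>\<open>H *v x\<close> sums over the second index, which is the conjugated one
      in the quadratic form; hence the conjugate of x.\<close>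
    define v where "v = (\<chi> i. cnj (x $ i))"
    have "v \<noteq> 0"
      using \<open>x \<noteq> 0\<close> by (auto simp: v_def vec_eq_iff)
    have "(\<Sum>i\<in>UNIV. \<Sum>j\<in>UNIV. H $ i $ j * v $ i * cnj (v $ j)) = (\<Sum>i\<in>UNIV. v $ i * (H *v x) $ i)"
      unfolding matrix_vector_mult_def by (simp add: v_def sum_distrib_left mult_ac)
    also have "\<dots> = 0"
      by (simp add: that)
    finally have "(\<Sum>i\<in>UNIV. \<Sum>j\<in>UNIV. H $ i $ j * v $ i * cnj (v $ j)) = 0" .
    moreover have "0 < Re (\<Sum>i\<in>UNIV. \<Sum>j\<in>UNIV. H $ i $ j * v $ i * cnj (v $ j))"
      by (rule hermitian_posdefD(2)[OF assms \<open>v \<noteq> 0\<close>])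
    ultimately show False
      by simp
  qed
  then show ?thesis
    by (simp add: invertible_left_inverse matrix_left_invertible_ker)
qed

text \<open>The segment K from the identity to H consists of positive definite Hermitian matrices.
  Their determinants are real and nonzero, and the first one is 1, so by the intermediate value
  theorem the last one is positive.\<close>

lemma hermitian_posdef_det_pos:
  fixes H :: "complex^'n::finite^'n"
  assumes H: "hermitian_posdef H"
  shows "0 < Re (det H)"
proof -
  define K where "K t = (\<chi> i j. (1 - complex_of_real t) * (if i = j then 1 else 0) + complex_of_real t * H $ i $ j)" for t
  have K: "hermitian_posdef (K t)" if t: "0 \<le> t" "t \<le> 1" for t
    unfolding hermitian_posdef_def
  proof (intro conjI allI impI)
    show "K t $ j $ i = cnj (K t $ i $ j)" for i j
      by (simp add: K_def hermitian_posdefD(1)[OF H])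
    fix v :: "complex^'n" assume v: "v \<noteq> 0"
    have pos: "0 < Re (\<Sum>i\<in>UNIV. \<Sum>j\<in>UNIV. H $ i $ j * v $ i * cnj (v $ j))"
      by (rule hermitian_posdefD(2)[OF H v])
    obtain i0 where "v $ i0 \<noteq> 0"
      using v by (auto simp: vec_eq_iff)
    then have pos': "0 < (\<Sum>i\<in>UNIV. (cmod (v $ i))\<^sup>2)"
      by (intro sum_pos2[of _ i0]) auto
    have "(\<Sum>i\<in>UNIV. \<Sum>j\<in>UNIV. K t $ i $ j * v $ i * cnj (v $ j))
        = (1 - of_real t) * (\<Sum>i\<in>UNIV. \<Sum>j\<in>UNIV. (if i = j then 1 else 0) * v $ i * cnj (v $ j))
          + of_real t * (\<Sum>i\<in>UNIV. \<Sum>j\<in>UNIV. H $ i $ j * v $ i * cnj (v $ j))"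
      unfolding sum_distrib_left sum.distrib[symmetric]
      by (intro sum.cong refl) (simp add: K_def algebra_simps)
    also have "(\<Sum>i\<in>UNIV. \<Sum>j\<in>UNIV. (if i = j then 1 else 0) * v $ i * cnj (v $ j))
        = of_real (\<Sum>i\<in>UNIV. (cmod (v $ i))\<^sup>2)"
      by (simp add: if_distrib[of "\<lambda>x. x * _"] cong: if_cong flip: complex_norm_square)
    finally have "Re (\<Sum>i\<in>UNIV. \<Sum>j\<in>UNIV. K t $ i $ j * v $ i * cnj (v $ j))
        = (1 - t) * (\<Sum>i\<in>UNIV. (cmod (v $ i))\<^sup>2)
          + t * Re (\<Sum>i\<in>UNIV. \<Sum>j\<in>UNIV. H $ i $ j * v $ i * cnj (v $ j))"
      by simp
    also have "\<dots> > 0"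
    proof (cases "t = 0")
      case True
      then show ?thesis using pos' by simp
    next
      case False
      then show ?thesis
        using t pos' pos by (intro add_nonneg_pos mult_nonneg_nonneg mult_pos_pos) auto
    qed
    finally show "0 < Re (\<Sum>i\<in>UNIV. \<Sum>j\<in>UNIV. K t $ i $ j * v $ i * cnj (v $ j))" .
  qed
  have nz: "Re (det (K t)) \<noteq> 0" if "0 \<le> t" "t \<le> 1" for t
  proof -
    have "cnj (det (K t)) = det (\<chi> i j. cnj (K t $ i $ j))"
      by (simp add: det_def)
    also have "(\<chi> i j. cnj (K t $ i $ j)) = transpose (K t)"
      by (simp add: transpose_def vec_eq_iff hermitian_posdefD(1)[OF K[OF that]])
    finally have "cnj (det (K t)) = det (K t)"
      by (simp add: det_transpose)
    then have "Im (det (K t)) = 0"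
      by (simp add: complex_eq_iff)
    moreover have "det (K t) \<noteq> 0"
      using hermitian_posdef_invertible[OF K[OF that]] invertible_det_nz by blast
    ultimately show ?thesis
      by (simp add: complex_eq_iff)
  qed
  have cont: "continuous_on {0..1} (\<lambda>t. Re (det (K t)))"
    unfolding det_def K_def by (intro continuous_intros; simp)
  have 0: "Re (det (K 0)) = 1"
  proof -
    have "K 0 = mat 1"
      by (simp add: K_def mat_def vec_eq_iff)
    then show ?thesis by simp
  qed
  have "K 1 = H"
    by (simp add: K_def vec_eq_iff)
  moreover have "0 < Re (det (K 1))"
  proof (rule ccontr)
    assume "\<not> ?thesis"
    then have "\<exists>t\<ge>0. t \<le> 1 \<and> Re (det (K t)) = 0"
      by (intro IVT2') (use 0 cont in auto)
    then show False using nz by blast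
  qed
  ultimately show ?thesis by simp
qed

section \<open>Determinants and inverses of matrix-valued functions\<close>

lemma differentiable_prod:
  fixes f :: "'i \<Rightarrow> 'a::real_normed_vector \<Rightarrow> 'b::real_normed_field"
  assumes "\<And>i. i \<in> I \<Longrightarrow> f i differentiable (at z)"
  shows "(\<lambda>x. \<Prod>i\<in>I. f i x) differentiable (at z)"
  using assms by (induction I rule: infinite_finite_induct) (auto intro: differentiable_mult)

lemma differentiable_det:
  fixes F :: "'a::real_normed_vector \<Rightarrow> complex^'n::finite^'n"
  assumes "\<And>i j. (\<lambda>z. F z $ i $ j) differentiable (at z)"
  shows "(\<lambda>z. det (F z)) differentiable (at z)"
  unfolding det_def
  by (intro differentiable_sum ballI differentiable_mult differentiable_const differentiable_prod assms) simp

lemma differentiable_matrix_inv: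
  fixes F :: "'a::real_normed_vector \<Rightarrow> complex^'n::finite^'n"
  assumes "open S" "z \<in> S" "\<And>y. y \<in> S \<Longrightarrow> invertible (F y)"
    and F: "\<And>i j. (\<lambda>z. F z $ i $ j) differentiable (at z)"
  shows "(\<lambda>z. matrix_inv (F z) $ i $ j) differentiable (at z)"
proof -
  \<comment> \<open>Cramer's rule: column i of F y is replaced by the j-th unit vector, so that the
    entry of the inverse becomes a quotient of determinants.\<close>
  define N where "N y = (\<chi> k l. if l = i then axis j 1 $ k else F y $ k $ l)" for y
  have eq: "det (N y) / det (F y) = matrix_inv (F y) $ i $ j" if "y \<in> S" for y
  proof -
    have nz: "det (F y) \<noteq> 0"
      using assms(3)[OF that] invertible_det_nz by blast
    have "F y *v (matrix_inv (F y) *v axis j 1) = axis j 1"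
      using matrix_inv_props(1)[OF assms(3)[OF that]] by (simp add: matrix_vector_mul_assoc)
    then have "(matrix_inv (F y) *v axis j 1) $ i = det (N y) / det (F y)"
      using cramer[OF nz, of "matrix_inv (F y) *v axis j 1" "axis j 1"] by (simp add: N_def)
    moreover have "(matrix_inv (F y) *v axis j 1) $ i = matrix_inv (F y) $ i $ j"
      by (simp add: matrix_vector_mult_def axis_def if_distrib[of "\<lambda>x. _ * x"] cong: if_cong)
    ultimately show ?thesis by simp
  qed
  have "(\<lambda>y. det (N y)) differentiable (at z)"
  proof (rule differentiable_det)
    show "(\<lambda>y. N y $ k $ l) differentiable (at z)" for k l
      by (cases "l = i") (simp_all add: N_def F)
  qed
  moreover have "det (F z) \<noteq> 0"
    using assms(3)[OF assms(2)] invertible_det_nz by blast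
  ultimately have "(\<lambda>y. det (N y) / det (F y)) differentiable (at z)"
    by (rule differentiable_divide[OF _ differentiable_det[OF F]])
  then obtain D where "((\<lambda>y. det (N y) / det (F y)) has_derivative D) (at z)"
    unfolding differentiable_def ..
  from has_derivative_transform_within_open[OF this assms(1,2), of "\<lambda>y. matrix_inv (F y) $ i $ j"]
  show ?thesis
    using eq differentiableI by auto
qed

lemma metric_inv_contract:
  assumes "invertible (H z)"
  shows "(\<Sum>j\<in>UNIV. metric_inv H z i j * H z $ k $ j) = (if i = k then 1 else 0)"
    and "(\<Sum>i\<in>UNIV. metric_inv H z i j * H z $ i $ k) = (if j = k then 1 else 0)"
  using matrix_mult_mat1_component[OF matrix_inv_props(1)[OF assms], of k i]
    matrix_mult_mat1_component[OF matrix_inv_props(2)[OF assms], of j k]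
  by (simp_all add: metric_inv_def mult.commute eq_commute)

text \<open>The conjugate transpose N of the inverse is also inverse to H, hence equal to
  it.\<close>

lemma metric_inv_hermitian:
  assumes H: "hermitian_posdef (H z)"
  shows "metric_inv H z j i = cnj (metric_inv H z i j)"
proof -
  define N where "N = (\<chi> i j. cnj (matrix_inv (H z) $ j $ i))"
  note inv = matrix_inv_props[OF hermitian_posdef_invertible[OF H]]
  have sym: "cnj (H z $ i $ j) = H z $ j $ i" for i j
    by (rule hermitian_posdefD(1)[OF H])
  have "H z ** N = mat 1"
  proof -
    have "(H z ** N) $ i $ j = cnj (\<Sum>k\<in>UNIV. matrix_inv (H z) $ j $ k * H z $ k $ i)" for i j
      by (simp add: matrix_matrix_mult_def N_def sym mult.commute)
    then show ?thesis
      unfolding matrix_mult_mat1_component[OF inv(2)] vec_eq_iff mat_def by auto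
  qed
  then have "N = matrix_inv (H z)"
    using matrix_mul_assoc[of "matrix_inv (H z)" "H z" N] inv(2) by simp
  from arg_cong[OF this, of "\<lambda>M. M $ i $ j"] show ?thesis
    by (simp add: metric_inv_def N_def)
qed

text \<open>Substituting v = H y turns the form of the inverse on v into the form of H on the
  conjugate of y.\<close>

lemma metric_inv_pos:
  assumes H: "hermitian_posdef (H z)" and "v \<noteq> 0"
  shows "0 < Re (\<Sum>i\<in>UNIV. \<Sum>j\<in>UNIV. metric_inv H z i j * v $ i * cnj (v $ j))"
proof -
  note inv = matrix_inv_props[OF hermitian_posdef_invertible[OF H]]
  define y where "y = matrix_inv (H z) *v v"
  define w where "w = (\<chi> i. cnj (y $ i))"
  have sym: "cnj (H z $ i $ j) = H z $ j $ i" for i j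
    by (rule hermitian_posdefD(1)[OF H])
  have v: "v = H z *v y"
    unfolding y_def by (simp add: matrix_vector_mul_assoc inv)
  then have "y \<noteq> 0"
    using \<open>v \<noteq> 0\<close> by auto
  then have "w \<noteq> 0"
    by (simp add: w_def vec_eq_iff)
  have "(\<Sum>i\<in>UNIV. \<Sum>j\<in>UNIV. metric_inv H z i j * v $ i * cnj (v $ j)) = (\<Sum>j\<in>UNIV. y $ j * cnj (v $ j))"
    by (subst sum.swap) (simp add: y_def matrix_vector_mult_def metric_inv_def sum_distrib_right)
  also have "\<dots> = (\<Sum>j\<in>UNIV. \<Sum>k\<in>UNIV. H z $ k $ j * w $ k * cnj (w $ j))"
    unfolding v by (simp add: matrix_vector_mult_def sum_distrib_left sym w_def mult_ac)
  also have "\<dots> = (\<Sum>k\<in>UNIV. \<Sum>j\<in>UNIV. H z $ k $ j * w $ k * cnj (w $ j))"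
    by (rule sum.swap)
  finally show ?thesis
    using hermitian_posdefD(2)[OF H \<open>w \<noteq> 0\<close>] by simp
qed

text \<open>The induction step splits off the rank-one matrix \<open>P_ik P_kj / P_kk\<close>; what remains is the Schur
  complement, which is positive definite in the remaining variables.\<close>

lemma Re_trace_mult_nonpos:
  fixes P L :: "'n \<Rightarrow> 'n \<Rightarrow> complex"
  assumes "finite I" "\<And>i j. P j i = cnj (P i j)"
    and "\<And>v. \<exists>i\<in>I. v i \<noteq> 0 \<Longrightarrow> 0 < Re (\<Sum>i\<in>I. \<Sum>j\<in>I. P i j * v i * cnj (v j))"
    and "\<And>a. Re (\<Sum>i\<in>I. \<Sum>j\<in>I. a i * cnj (a j) * L i j) \<le> 0"
  shows "Re (\<Sum>i\<in>I. \<Sum>j\<in>I. P i j * L i j) \<le> 0"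
  using assms
proof (induction I arbitrary: P rule: finite_induct)
  case empty
  show ?case by simp
next
  case (insert k I)
  let ?J = "insert k I"
  note sym = insert.prems(1) and pos = insert.prems(2) and neg = insert.prems(3)
  define p where "p = Re (P k k)"
  have pk: "P k k = of_real p"
    using sym[of k k] by (simp add: p_def complex_eq_iff)
  have p: "0 < p"
    using pos[of "\<lambda>i. if i = k then 1 else 0"] insert.hyps
    by (simp add: if_distrib[of "\<lambda>x. _ * x"] if_distrib[of cnj] pk cong: if_cong)
  define Q where "Q i j = P i j - P i k * P k j / of_real p" for i j
  have Q0: "Q i k = 0" "Q k i = 0" for i
    using p by (simp_all add: Q_def pk)
  have drop: "(\<Sum>i\<in>?J. \<Sum>j\<in>?J. Q i j * M i j) = (\<Sum>i\<in>I. \<Sum>j\<in>I. Q i j * M i j)" for M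
    using insert.hyps by (simp add: Q0)
  have split: "(\<Sum>i\<in>?J. \<Sum>j\<in>?J. P i j * M i j)
      = (\<Sum>i\<in>I. \<Sum>j\<in>I. Q i j * M i j) + (\<Sum>i\<in>?J. \<Sum>j\<in>?J. P i k * P k j * M i j) / of_real p" for M
    unfolding drop[symmetric] sum_divide_distrib sum.distrib[symmetric]
    by (intro sum.cong refl) (simp add: Q_def algebra_simps)
  have "Re (\<Sum>i\<in>I. \<Sum>j\<in>I. Q i j * L i j) \<le> 0"
  proof (rule insert.IH)
    show "Q j i = cnj (Q i j)" for i j
      unfolding Q_def complex_cnj_diff complex_cnj_divide complex_cnj_mult sym[symmetric]
      by (simp add: mult.commute)
    show "0 < Re (\<Sum>i\<in>I. \<Sum>j\<in>I. Q i j * v i * cnj (v j))" if v: "\<exists>i\<in>I. v i \<noteq> 0" for v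
    proof -
      \<comment> \<open>The entry at k is chosen so that the sum of P_ik u_i vanishes. This kills
        the rank-one part, and the form of P on u equals the form of Q on v.\<close>
      define u where "u i = (if i = k then - (\<Sum>i\<in>I. P i k * v i) / of_real p else v i)" for i
      have uI: "u i = v i" if "i \<in> I" for i
        using that insert.hyps by (auto simp: u_def)
      have 0: "(\<Sum>i\<in>?J. P i k * u i) = 0"
        using insert.hyps p by (simp add: pk uI) (simp add: u_def)
      have "(\<Sum>i\<in>?J. \<Sum>j\<in>?J. P i k * P k j * (u i * cnj (u j)))
          = (\<Sum>i\<in>?J. P i k * u i) * (\<Sum>j\<in>?J. P k j * cnj (u j))"
        unfolding sum_product by (intro sum.cong refl) (simp add: mult_ac)
      then have "(\<Sum>i\<in>?J. \<Sum>j\<in>?J. P i j * (u i * cnj (u j))) = (\<Sum>i\<in>I. \<Sum>j\<in>I. Q i j * (u i * cnj (u j)))"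
        unfolding split[of "\<lambda>i j. u i * cnj (u j)"] 0 by simp
      also have "\<dots> = (\<Sum>i\<in>I. \<Sum>j\<in>I. Q i j * v i * cnj (v j))"
        by (intro sum.cong refl) (simp add: uI mult.assoc)
      finally have "(\<Sum>i\<in>I. \<Sum>j\<in>I. Q i j * v i * cnj (v j)) = (\<Sum>i\<in>?J. \<Sum>j\<in>?J. P i j * u i * cnj (u j))"
        by (simp only: mult.assoc)
      then show ?thesis
        using pos[of u] v uI by auto
    qed
    show "Re (\<Sum>i\<in>I. \<Sum>j\<in>I. a i * cnj (a j) * L i j) \<le> 0" for a
    proof -
      define b where "b i = (if i = k then 0 else a i)" for i
      have "b k = 0" "\<And>i. i \<in> I \<Longrightarrow> b i = a i"
        using insert.hyps by (auto simp: b_def)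
      then have "(\<Sum>i\<in>?J. \<Sum>j\<in>?J. b i * cnj (b j) * L i j) = (\<Sum>i\<in>I. \<Sum>j\<in>I. a i * cnj (a j) * L i j)"
        using insert.hyps by (simp cong: sum.cong)
      then show ?thesis
        using neg[of b] by simp
    qed
  qed
  \<comment> \<open>Since P_kj is the conjugate of P_jk, the rank-one part pairs L with the vector
    a_i = P_ik, to which the hypothesis on L applies directly.\<close>
  moreover have "Re ((\<Sum>i\<in>?J. \<Sum>j\<in>?J. P i k * P k j * L i j) / of_real p) \<le> 0"
  proof -
    have "(\<Sum>i\<in>?J. \<Sum>j\<in>?J. P i k * P k j * L i j) = (\<Sum>i\<in>?J. \<Sum>j\<in>?J. P i k * cnj (P j k) * L i j)"
      by (intro sum.cong refl arg_cong2[where f="(*)"] sym)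
    then show ?thesis
      using divide_nonpos_pos[OF neg[of "\<lambda>i. P i k"] p] by (simp only: Re_divide_of_real)
  qed
  ultimately show ?case
    by (simp only: split[of L] plus_complex.sel add_nonpos_nonpos)
qed

section \<open>Conformal change of the Chern scalar curvature\<close>

lemma matrix_inv_eqI:
  fixes A B :: "complex^'n::finite^'n"
  assumes "A ** B = mat 1"
  shows "matrix_inv A = B"
proof -
  have "invertible A"
    using assms invertible_right_inverse by blast
  from matrix_mul_assoc[of "matrix_inv A" A B] show ?thesis
    by (simp add: assms matrix_inv_props(2)[OF \<open>invertible A\<close>])
qed

lemma metric_inv_scaleR:
  assumes "invertible (H z)" "H' z = c *\<^sub>R H z" "c \<noteq> 0"
  shows "metric_inv H' z i j = of_real (inverse c) * metric_inv H z i j"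
proof -
  have "H' z ** (inverse c *\<^sub>R matrix_inv (H z)) = mat 1"
    unfolding assms(2) matrix_inv_props(1)[OF assms(1), symmetric]
    by (simp add: matrix_matrix_mult_def vec_eq_iff assms(3) scaleR_sum_right)
  from matrix_inv_eqI[OF this] show ?thesis
    by (simp add: metric_inv_def scaleR_conv_of_real[where 'a=complex] vec_eq_iff)
qed

definition scalar_contraction :: "'n::finite local_metric \<Rightarrow> complex^'n \<Rightarrow> complex" where
  "scalar_contraction H z = (\<Sum>i\<in>UNIV. \<Sum>j\<in>UNIV. \<Sum>k\<in>UNIV. \<Sum>l\<in>UNIV.
     metric_inv H z i j * metric_inv H z k l * chern_curvature H z i j k l)"

text \<open>The metric trace of the complex Hessian: -2 times it is the expression in
  \<open>chern_laplacian\<close>, up to the order of the Wirtinger derivatives.\<close>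

definition levi_trace :: "'n::finite local_metric \<Rightarrow> (complex^'n \<Rightarrow> real) \<Rightarrow> complex^'n \<Rightarrow> complex" where
  "levi_trace H f z = (\<Sum>i\<in>UNIV. \<Sum>j\<in>UNIV. metric_inv H z i j * levi f z i j)"

lemma levi_trace_linear:
  assumes "open S" "smooth_on S f" "smooth_on S g" "z \<in> S"
  shows "levi_trace H (\<lambda>z. a * f z + b * g z) z = a * levi_trace H f z + b * levi_trace H g z"
  unfolding levi_trace_def levi_linear[OF assms] sum_distrib_left sum.distrib[symmetric]
  by (intro sum.cong refl) (simp add: algebra_simps)

text \<open>The maximum principle: at a maximum the Levi form is negative semidefinite, and its
  contraction with the positive definite inverse metric is nonpositive.\<close>

lemma Re_levi_trace_nonpos_at_max:
  assumes "hermitian_posdef (H z)"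
    and "open S" "smooth_on S f" "z \<in> S" "\<And>y. y \<in> S \<Longrightarrow> f y \<le> f z"
  shows "Re (levi_trace H f z) \<le> 0"
  unfolding levi_trace_def
proof (rule Re_trace_mult_nonpos)
  show "metric_inv H z j i = cnj (metric_inv H z i j)" for i j
    by (rule metric_inv_hermitian[of H z, OF assms(1)])
  fix v :: "'a \<Rightarrow> complex"
  show "Re (\<Sum>i\<in>UNIV. \<Sum>j\<in>UNIV. v i * cnj (v j) * levi f z i j) \<le> 0"
    using levi_form_nonpos_at_max[OF assms(2-5), of "\<chi> i. v i"] by simp
  assume "\<exists>i\<in>UNIV. v i \<noteq> 0"
  then have "(\<chi> i. v i) \<noteq> 0"
    by (simp add: vec_eq_iff)
  from metric_inv_pos[of H z, OF assms(1) this]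
  show "0 < Re (\<Sum>i\<in>UNIV. \<Sum>j\<in>UNIV. metric_inv H z i j * v i * cnj (v j))"
    by simp
qed simp

text \<open>The computation in a single chart. The exponent \<phi> will be 2u/n.\<close>

locale local_conformal =
  fixes S :: "(complex^'n::finite) set" and H H' :: "'n local_metric" and \<phi> :: "complex^'n \<Rightarrow> real"
  assumes open_S: "open S"
    and smooth_H: "\<And>i j. smooth_on S (\<lambda>z. H z $ i $ j)"
    and inv_H: "\<And>z. z \<in> S \<Longrightarrow> invertible (H z)"
    and smooth_\<phi>: "smooth_on S \<phi>"
    and H'_eq: "\<And>z. z \<in> S \<Longrightarrow> H' z = exp (\<phi> z) *\<^sub>R H z"
begin

lemma metric_inv_conformal:
  "z \<in> S \<Longrightarrow> metric_inv H' z i j = of_real (exp (- \<phi> z)) * metric_inv H z i j"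
  using metric_inv_scaleR[of H z H', OF inv_H H'_eq] by (simp add: exp_minus)

lemma differentiable_chern_connection:
  assumes "z \<in> S"
  shows "chern_connection H i k p differentiable (at z)"
  unfolding chern_connection_def[abs_def] metric_inv_def
  by (intro differentiable_sum ballI differentiable_mult differentiable_matrix_inv[OF open_S assms inv_H]
      smooth_on_differentiable[OF smooth_H assms]
      smooth_on_differentiable[OF smooth_on_dz[OF open_S smooth_H] assms]) simp_all

lemma dz_conformal:
  assumes z: "z \<in> S"
  shows "dz i (\<lambda>z. H' z $ k $ q) z = of_real (exp (\<phi> z)) *
    (dz i (\<lambda>z. complex_of_real (\<phi> z)) z * H z $ k $ q + dz i (\<lambda>z. H z $ k $ q) z)"
proof -
  note d = smooth_on_has_derivative[OF smooth_\<phi> z]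
  have e: "((\<lambda>z. complex_of_real (exp (\<phi> z))) has_derivative
      (\<lambda>v. complex_of_real (exp (\<phi> z) * frechet_derivative \<phi> (at z) v))) (at z)"
    by (intro has_derivative_of_real) (use has_derivative_exp[OF d] in \<open>simp add: mult.commute\<close>)
  have "dz i (\<lambda>z. H' z $ k $ q) z = dz i (\<lambda>z. complex_of_real (exp (\<phi> z)) * H z $ k $ q) z"
    by (rule dz_cong[OF open_S z]) (simp add: H'_eq scaleR_conv_of_real[where 'a=complex])
  also have "\<dots> = dz i (\<lambda>z. complex_of_real (exp (\<phi> z))) z * H z $ k $ q
      + complex_of_real (exp (\<phi> z)) * dz i (\<lambda>z. H z $ k $ q) z"
    by (rule dz_mult[OF differentiableI[OF e] smooth_on_differentiable[OF smooth_H z]])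
  also have "dz i (\<lambda>z. complex_of_real (exp (\<phi> z))) z
      = of_real (exp (\<phi> z)) * dz i (\<lambda>z. complex_of_real (\<phi> z)) z"
    unfolding dz_eq[OF e] dz_eq[OF has_derivative_of_real[OF d]] by (simp add: field_simps)
  finally show ?thesis
    by (simp add: algebra_simps)
qed

text \<open>The connection matrix is the logarithmic derivative of the metric: the factor
  exp(\<phi>) cancels and leaves \<open>dz\<close> of \<phi> times the identity.\<close>

lemma chern_connection_conformal:
  assumes z: "z \<in> S"
  shows "chern_connection H' i k p z =
    chern_connection H i k p z + (if p = k then 1 else 0) * dz i (\<lambda>z. complex_of_real (\<phi> z)) z"
proof -
  have "chern_connection H' i k p z = (\<Sum>q\<in>UNIV. metric_inv H z p q *
      (dz i (\<lambda>z. complex_of_real (\<phi> z)) z * H z $ k $ q + dz i (\<lambda>z. H z $ k $ q) z))"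
    unfolding chern_connection_def
    by (intro sum.cong refl) (simp add: metric_inv_conformal[OF z] dz_conformal[OF z] exp_minus)
  also have "\<dots> = chern_connection H i k p z
      + (\<Sum>q\<in>UNIV. metric_inv H z p q * H z $ k $ q) * dz i (\<lambda>z. complex_of_real (\<phi> z)) z"
    unfolding chern_connection_def sum_distrib_right sum.distrib[symmetric]
    by (intro sum.cong refl) (simp add: algebra_simps)
  finally show ?thesis
    by (simp add: metric_inv_contract(1)[where H=H, OF inv_H[OF z]])
qed

text \<open>Applying - \<open>dzbar\<close> to the extra connection term gives minus the Levi form
  of \<phi> times the identity. Lowering the index with the new metric turns the identity into H and
  yields exp(\<phi>).\<close>

lemma chern_curvature_conformal:
  assumes z: "z \<in> S"
  shows "chern_curvature H' z i j k l =
    of_real (exp (\<phi> z)) * (chern_curvature H z i j k l - levi \<phi> z i j * H z $ k $ l)"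
proof -
  have *: "dzbar j (chern_connection H' i k p) z
      = dzbar j (chern_connection H i k p) z + (if p = k then 1 else 0) * levi \<phi> z i j" for p
  proof -
    note d = smooth_on_differentiable[OF smooth_on_dz[OF open_S smooth_on_of_real[OF open_S smooth_\<phi>]] z]
    have "dzbar j (chern_connection H' i k p) z = dzbar j (\<lambda>z. chern_connection H i k p z
        + (if p = k then 1 else 0) * dz i (\<lambda>z. complex_of_real (\<phi> z)) z) z"
      by (rule dz_cong[OF open_S z chern_connection_conformal])
    also have "\<dots> = dzbar j (chern_connection H i k p) z
        + (if p = k then 1 else 0) * dzbar j (dz i (\<lambda>z. complex_of_real (\<phi> z))) z"
      using dzbar_add[OF differentiable_chern_connection[OF z] differentiable_mult[OF differentiable_const d]]
        dzbar_cmult[OF d] by simp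
    finally show ?thesis
      by (simp add: levi_def)
  qed
  have "chern_curvature H' z i j k l = (\<Sum>p\<in>UNIV. of_real (exp (\<phi> z)) *
      (- dzbar j (chern_connection H i k p) z * H z $ p $ l - levi \<phi> z i j * (if p = k then H z $ p $ l else 0)))"
    unfolding chern_curvature_def *
    by (intro sum.cong refl) (simp add: H'_eq[OF z] scaleR_conv_of_real[where 'a=complex] algebra_simps)
  also have "\<dots> = of_real (exp (\<phi> z)) * (chern_curvature H z i j k l
      - levi \<phi> z i j * (\<Sum>p\<in>UNIV. if p = k then H z $ p $ l else 0))"
    unfolding chern_curvature_def sum_distrib_left[symmetric] sum_subtractf ..
  finally show ?thesis
    by simp
qed

text \<open>Two inverse metrics contribute exp(-2 \<phi>), the curvature exp(\<phi>). The
  contraction of H with its own inverse is the dimension.\<close>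

lemma scalar_contraction_conformal:
  assumes z: "z \<in> S"
  shows "scalar_contraction H' z =
    of_real (exp (- \<phi> z)) * (scalar_contraction H z - of_nat CARD('n) * levi_trace H \<phi> z)"
proof -
  let ?m = "metric_inv H z"
  have n: "(\<Sum>k\<in>UNIV. \<Sum>l\<in>UNIV. ?m k l * H z $ k $ l) = of_nat CARD('n)"
    by (simp add: metric_inv_contract(1)[where H=H, OF inv_H[OF z]])
  have "scalar_contraction H' z = (\<Sum>i\<in>UNIV. \<Sum>j\<in>UNIV. \<Sum>k\<in>UNIV. \<Sum>l\<in>UNIV. of_real (exp (- \<phi> z)) *
      (?m i j * ?m k l * chern_curvature H z i j k l - ?m i j * levi \<phi> z i j * (?m k l * H z $ k $ l)))"
    unfolding scalar_contraction_def
    by (intro sum.cong refl)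
      (simp add: metric_inv_conformal[OF z] chern_curvature_conformal[OF z] exp_minus field_simps)
  also have "\<dots> = of_real (exp (- \<phi> z)) * (scalar_contraction H z
      - (\<Sum>i\<in>UNIV. \<Sum>j\<in>UNIV. ?m i j * levi \<phi> z i j * (\<Sum>k\<in>UNIV. \<Sum>l\<in>UNIV. ?m k l * H z $ k $ l)))"
    unfolding scalar_contraction_def sum_distrib_left[symmetric] sum_subtractf ..
  finally show ?thesis
    unfolding n levi_trace_def sum_distrib_right[symmetric] by (simp add: mult.commute)
qed

end

section \<open>Charts and the conformal change formula on the manifold\<close>

lemma complex_atlas_chart:
  assumes "complex_atlas A" "c \<in> A"
  shows "open (fst c)" "open (chart_image c)" "homeomorphism (fst c) (chart_image c) (snd c) (chart_inv c)"
  using assms unfolding complex_atlas_def by auto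

lemma chart_inv_left: "complex_atlas A \<Longrightarrow> c \<in> A \<Longrightarrow> p \<in> fst c \<Longrightarrow> chart_inv c (snd c p) = p"
  and chart_inv_right: "complex_atlas A \<Longrightarrow> c \<in> A \<Longrightarrow> z \<in> chart_image c \<Longrightarrow> snd c (chart_inv c z) = z"
  and chart_inv_in: "complex_atlas A \<Longrightarrow> c \<in> A \<Longrightarrow> z \<in> chart_image c \<Longrightarrow> chart_inv c z \<in> fst c"
  using complex_atlas_chart(3)[of A c] by (auto simp: homeomorphism_def)

lemma chart_at:
  assumes "complex_atlas A"
  shows "chart_at A p \<in> A" "p \<in> fst (chart_at A p)"
proof -
  have "\<exists>c. c \<in> A \<and> p \<in> fst c"
    using assms unfolding complex_atlas_def by blast
  from someI_ex[OF this] show "chart_at A p \<in> A" "p \<in> fst (chart_at A p)"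
    unfolding chart_at_def by auto
qed

lemma hermitian_metric_local:
  assumes "hermitian_metric A \<omega>" "c \<in> A"
  shows "smooth_on (chart_image c) (\<lambda>z. \<omega> c z $ i $ j)"
    and "z \<in> chart_image c \<Longrightarrow> hermitian_posdef (\<omega> c z)"
  using assms unfolding hermitian_metric_def hermitian_posdef_def by blast+

text \<open>The normalisation exp(2u/n) makes the dimension factor of the contraction cancel, which
  leaves the coefficient 2.\<close>

lemma chern_scalar_conformal:
  fixes A :: "('a::{t2_space,second_countable_topology}, 'n::finite) chart set"
  fixes p :: 'a
  assumes A: "complex_atlas A" and \<omega>: "hermitian_metric A \<omega>" and u: "smooth_fun A u"
    and \<omega>': "\<forall>c\<in>A. \<forall>z\<in>chart_image c. \<omega>' c z = exp (2 * u (chart_inv c z) / real CARD('n)) *\<^sub>R \<omega> c z"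
  defines "c \<equiv> chart_at A p"
  shows "chern_scalar A \<omega>' p = exp (- 2 * u p / real CARD('n)) *
    (chern_scalar A \<omega> p - 2 * Re (levi_trace (\<omega> c) (\<lambda>z. u (chart_inv c z)) (snd c p)))"
proof -
  note c = chart_at[OF A, of p, folded c_def]
  let ?S = "chart_image c" and ?n = "real CARD('n)" and ?z = "snd c p"
  let ?u = "\<lambda>z. u (chart_inv c z)"
  have z: "?z \<in> ?S"
    using c(2) by simp
  have u': "smooth_on ?S ?u"
    using u c(1) unfolding smooth_fun_def by (simp add: comp_def)
  note open_S = complex_atlas_chart(2)[OF A c(1)]
  \<comment> \<open>The vanishing second summand gives the exponent the shape of
    \<open>levi_trace_linear\<close>.\<close>
  interpret local_conformal ?S "\<omega> c" "\<omega>' c" "\<lambda>z. 2 / ?n * ?u z + 0 * ?u z"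
  proof
    show "smooth_on ?S (\<lambda>z. 2 / ?n * ?u z + 0 * ?u z)"
      by (intro smooth_on_add smooth_on_mult smooth_on_const open_S u')
    show "invertible (\<omega> c z)" if "z \<in> ?S" for z
      by (rule hermitian_posdef_invertible[OF hermitian_metric_local(2)[OF \<omega> c(1) that]])
  qed (use hermitian_metric_local(1)[OF \<omega> c(1)] open_S \<omega>' c(1) in auto)
  have "scalar_contraction (\<omega>' c) ?z = of_real (exp (- 2 * u p / ?n)) *
      (scalar_contraction (\<omega> c) ?z - 2 * levi_trace (\<omega> c) ?u ?z)"
    using scalar_contraction_conformal[OF z]
    unfolding levi_trace_linear[OF open_S u' u' z] by (simp add: chart_inv_left[OF A c])
  then show ?thesis
    by (simp add: chern_scalar_def Let_def c_def[symmetric] scalar_contraction_def[symmetric])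
qed

section \<open>The squared coordinate distance in other charts\<close>

lemma open_chart_image_Int:
  assumes "complex_atlas A" "d \<in> A" "open W"
  shows "open (snd d ` (fst d \<inter> W))"
proof -
  have "snd d ` (fst d \<inter> W) = chart_image d \<inter> chart_inv d -` W"
    using chart_inv_left[OF assms(1,2)] chart_inv_right[OF assms(1,2)] chart_inv_in[OF assms(1,2)] by force
  moreover have "open (chart_image d \<inter> chart_inv d -` W)"
    using complex_atlas_chart(2,3)[OF assms(1,2)] assms(3)
    by (intro continuous_open_preimage) (auto simp: homeomorphism_def)
  ultimately show ?thesis by simp
qed

lemma holomorphic_map_on_component:
  assumes "holomorphic_map_on S T"
  shows "holomorphic_fun_on S (\<lambda>z. T z $ k - b)"
  unfolding holomorphic_fun_on_def
proof
  fix z assume "z \<in> S"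
  then obtain D where D: "(T has_derivative D) (at z)" "\<And>a v. D (a *s v) = a *s D v"
    using assms unfolding holomorphic_map_on_def by blast
  have "((\<lambda>z. T z $ k - b) has_derivative (\<lambda>v. D v $ k - 0)) (at z)"
    by (intro has_derivative_diff has_derivative_const bounded_linear.has_derivative[OF bounded_linear_vec_nth] D)
  then show "\<exists>D. ((\<lambda>z. T z $ k - b) has_derivative D) (at z) \<and> (\<forall>a v. D (a *s v) = a * D v)"
    using D(2) by (intro exI[of _ "\<lambda>v. D v $ k"]) simp
qed

lemma holomorphic_transition:
  "complex_atlas A \<Longrightarrow> c \<in> A \<Longrightarrow> d \<in> A \<Longrightarrow>
    holomorphic_fun_on (snd c ` (fst c \<inter> fst d)) (\<lambda>z. transition c d z $ k - b)"
  by (rule holomorphic_map_on_component) (auto simp: complex_atlas_def)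

text \<open>In |f|^2 = f cnj(f), \<open>dz\<close> does not see the antiholomorphic factor, and
  afterwards \<open>dzbar\<close> does not see \<open>dz i f\<close>, which is again
  holomorphic.\<close>

lemma levi_sum_norm_squared:
  fixes f :: "'k::finite \<Rightarrow> complex^'n::finite \<Rightarrow> complex"
  assumes "open S" and f: "\<And>k. holomorphic_fun_on S (f k)" and z: "z \<in> S"
  shows "levi (\<lambda>z. \<Sum>k\<in>UNIV. (norm (f k z))\<^sup>2) z i j = (\<Sum>k\<in>UNIV. dz i (f k) z * cnj (dz j (f k) z))"
proof -
  have df: "f k differentiable (at y)" "(\<lambda>y. cnj (f k y)) differentiable (at y)" if "y \<in> S" for k y
    using holomorphic_fun_on_derivative(1)[OF f that]
    by (blast intro: differentiableI has_derivative_cnj)+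
  have smooth_f: "smooth_on S (f k)" for k
    by (rule smooth_on_holomorphic[OF assms(1) f])
  have ddf: "dz i (f k) differentiable (at z)" for k
    by (rule smooth_on_differentiable[OF smooth_on_dz[OF assms(1) smooth_f] z])
  have 1: "dz i (\<lambda>z. complex_of_real (\<Sum>k\<in>UNIV. (norm (f k z))\<^sup>2)) y = (\<Sum>k\<in>UNIV. dz i (f k) y * cnj (f k y))"
    if y: "y \<in> S" for y
  proof -
    have "dz i (\<lambda>z. complex_of_real (\<Sum>k\<in>UNIV. (norm (f k z))\<^sup>2)) y = dz i (\<lambda>z. \<Sum>k\<in>UNIV. f k z * cnj (f k z)) y"
      unfolding of_real_sum complex_norm_square ..
    also have "\<dots> = (\<Sum>k\<in>UNIV. dz i (\<lambda>z. f k z * cnj (f k z)) y)"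
      by (intro dz_sum differentiable_mult df y) simp
    also have "\<dots> = (\<Sum>k\<in>UNIV. dz i (f k) y * cnj (f k y))"
      by (intro sum.cong refl) (simp add: dz_mult df y dz_cnj dzbar_holomorphic[OF f y])
    finally show ?thesis .
  qed
  have hol: "dzbar j (dz i (f k)) z = 0" for k
  proof -
    have "dzbar j (dz i (f k)) z = dzbar j (\<lambda>y. frechet_derivative (f k) (at y) (axis i 1)) z"
      by (rule dz_cong[OF assms(1) z dz_holomorphic[OF f]])
    also have "\<dots> = 0"
      by (rule dzbar_holomorphic[OF holomorphic_fun_on_frechet_derivative[OF assms(1) f] z])
    finally show ?thesis .
  qed
  have "levi (\<lambda>z. \<Sum>k\<in>UNIV. (norm (f k z))\<^sup>2) z i j = dzbar j (\<lambda>y. \<Sum>k\<in>UNIV. dz i (f k) y * cnj (f k y)) z"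
    unfolding levi_def by (rule dz_cong[OF assms(1) z 1])
  also have "\<dots> = (\<Sum>k\<in>UNIV. dzbar j (\<lambda>y. dz i (f k) y * cnj (f k y)) z)"
    by (intro dzbar_sum differentiable_mult ddf df z) simp
  also have "\<dots> = (\<Sum>k\<in>UNIV. dz i (f k) z * cnj (dz j (f k) z))"
    by (intro sum.cong refl) (simp add: dzbar_mult ddf df z dzbar_cnj hol)
  finally show ?thesis .
qed

text \<open>With J the Jacobian of a transition map, H = M K N, where N is the conjugate transpose
  of M. Then K^(-1) = N H^(-1) M, and the left-hand side is the trace of that product. So the trace
  can be computed in either chart.\<close>

lemma metric_inv_pullback_trace:
  fixes H K :: "'n::finite local_metric"
  assumes "invertible (H z)"
    and HK: "\<And>i j. H z $ i $ j = (\<Sum>k\<in>UNIV. \<Sum>l\<in>UNIV. J i k * cnj (J j l) * K w $ k $ l)"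
  shows "(\<Sum>i\<in>UNIV. \<Sum>j\<in>UNIV. metric_inv H z i j * (\<Sum>k\<in>UNIV. J i k * cnj (J j k))) = (\<Sum>k\<in>UNIV. metric_inv K w k k)"
proof -
  define M where "M = (\<chi> i k. J i k)"
  define N where "N = (\<chi> l j. cnj (J j l))"
  let ?I = "matrix_inv (H z)"
  have "H z = M ** (K w ** N)"
    by (simp add: vec_eq_iff HK M_def N_def matrix_matrix_mult_def sum_distrib_left mult_ac)
  then have "M ** (K w ** N ** ?I) = mat 1"
    using matrix_inv_props(1)[OF assms(1)] by (simp add: matrix_mul_assoc)
  \<comment> \<open>One-sided inverses of square matrices are two-sided, so M moves to the other end
    of the product.\<close>
  then have "(K w ** N ** ?I) ** M = mat 1"
    by (rule matrix_left_right_inverse[THEN iffD1])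
  then have "K w ** (N ** ?I ** M) = mat 1"
    by (simp add: matrix_mul_assoc)
  then have "matrix_inv (K w) = N ** ?I ** M"
    by (rule matrix_inv_eqI)
  then have "(\<Sum>k\<in>UNIV. metric_inv K w k k) = (\<Sum>k\<in>UNIV. \<Sum>i\<in>UNIV. \<Sum>j\<in>UNIV. N $ k $ j * ?I $ j $ i * M $ i $ k)"
    by (simp add: metric_inv_def matrix_matrix_mult_def sum_distrib_right)
  also have "\<dots> = (\<Sum>i\<in>UNIV. \<Sum>k\<in>UNIV. \<Sum>j\<in>UNIV. N $ k $ j * ?I $ j $ i * M $ i $ k)"
    by (rule sum.swap)
  also have "\<dots> = (\<Sum>i\<in>UNIV. \<Sum>j\<in>UNIV. \<Sum>k\<in>UNIV. N $ k $ j * ?I $ j $ i * M $ i $ k)"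
    by (intro sum.cong refl sum.swap)
  finally show ?thesis
    by (simp add: sum_distrib_left metric_inv_def M_def N_def mult_ac)
qed

lemma norm_squared_vec: "(norm (v :: complex^'n::finite))\<^sup>2 = (\<Sum>k\<in>UNIV. (norm (v $ k))\<^sup>2)"
  by (simp add: norm_vec_def L2_set_def sum_nonneg)

lemma levi_trace_const: "levi_trace (H :: 'n::finite local_metric) (\<lambda>z. b) z = 0"
proof -
  have "dz i (\<lambda>z. complex_of_real b) = (\<lambda>z. 0)" for i :: 'n
    by (rule ext) simp
  then show ?thesis
    by (simp add: levi_trace_def levi_def)
qed

context
  fixes A :: "('a::{t2_space,second_countable_topology}, 'n::finite) chart set"
  assumes A: "complex_atlas A"
begin

lemma smooth_on_coordinate_distance:
  assumes "c \<in> A" "d \<in> A"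
  shows "smooth_on (snd d ` (fst d \<inter> fst c)) (\<lambda>z. (norm (snd c (chart_inv d z) - z0))\<^sup>2)"
proof -
  let ?S = "snd d ` (fst d \<inter> fst c)"
  have S: "open ?S"
    by (rule open_chart_image_Int[OF A assms(2) complex_atlas_chart(1)[OF A assms(1)]])
  have T: "smooth_on ?S (\<lambda>z. transition d c z $ k - z0 $ k)" for k
    by (rule smooth_on_holomorphic[OF S holomorphic_transition[OF A assms(2,1)]])
  have "smooth_on ?S (\<lambda>z. Re (\<Sum>k\<in>UNIV. (transition d c z $ k - z0 $ k) * cnj (transition d c z $ k - z0 $ k)))"
    by (intro smooth_on_bounded_linear[OF S bounded_linear_Re] smooth_on_sum smooth_on_mult S T
        smooth_on_bounded_linear[OF S bounded_linear_cnj])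
  moreover have "Re (\<Sum>k\<in>UNIV. (transition d c z $ k - z0 $ k) * cnj (transition d c z $ k - z0 $ k))
      = (norm (snd c (chart_inv d z) - z0))\<^sup>2" for z
    unfolding norm_squared_vec Re_sum transition_def comp_def vector_minus_component complex_mult_cnj cmod_power2
    by simp
  ultimately show ?thesis
    by simp
qed

text \<open>In the chart c the Levi form of the squared distance is the identity matrix. The
  transformation law of the metric brings the trace in any chart d back to c, where it has a bound
  independent of d.\<close>

lemma levi_trace_coordinate_distance:
  assumes \<omega>: "hermitian_metric A \<omega>" and cd: "c \<in> A" "d \<in> A" "x \<in> fst c" "x \<in> fst d"
  shows "levi_trace (\<omega> d) (\<lambda>z. (norm (snd c (chart_inv d z) - z0))\<^sup>2) (snd d x)
    = (\<Sum>k\<in>UNIV. metric_inv (\<omega> c) (snd c x) k k)"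
proof -
  let ?S = "snd d ` (fst d \<inter> fst c)" and ?z = "snd d x"
  have S: "open ?S"
    by (rule open_chart_image_Int[OF A cd(2) complex_atlas_chart(1)[OF A cd(1)]])
  have z: "?z \<in> ?S"
    using cd by simp
  note hol = holomorphic_transition[OF A cd(2,1)]
  have J: "dz i (\<lambda>z. transition d c z $ k - z0 $ k) ?z = dz i (\<lambda>z. transition d c z $ k) ?z" for i k
  proof -
    have "(\<lambda>z. transition d c z $ k) differentiable (at ?z)"
      using holomorphic_fun_on_derivative(1)[OF hol[of k 0] z] by (auto intro: differentiableI)
    then show ?thesis
      using dz_add[of "\<lambda>z. transition d c z $ k" ?z "\<lambda>_. - z0 $ k" i] by simp
  qed
  have "levi (\<lambda>z. (norm (snd c (chart_inv d z) - z0))\<^sup>2) ?z i j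
      = (\<Sum>k\<in>UNIV. dz i (\<lambda>z. transition d c z $ k) ?z * cnj (dz j (\<lambda>z. transition d c z $ k) ?z))" for i j
    using levi_sum_norm_squared[where f="\<lambda>k z. transition d c z $ k - z0 $ k" and i=i and j=j, OF S hol z]
    by (simp add: norm_squared_vec transition_def comp_def J[unfolded transition_def comp_def])
  then have "levi_trace (\<omega> d) (\<lambda>z. (norm (snd c (chart_inv d z) - z0))\<^sup>2) ?z
      = (\<Sum>i\<in>UNIV. \<Sum>j\<in>UNIV. metric_inv (\<omega> d) ?z i j *
          (\<Sum>k\<in>UNIV. dz i (\<lambda>z. transition d c z $ k) ?z * cnj (dz j (\<lambda>z. transition d c z $ k) ?z)))"
    by (simp add: levi_trace_def)
  also have "\<dots> = (\<Sum>k\<in>UNIV. metric_inv (\<omega> c) (snd c x) k k)"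
  proof (rule metric_inv_pullback_trace)
    have "?z \<in> chart_image d"
      using cd by simp
    then show "invertible (\<omega> d ?z)"
      by (rule hermitian_posdef_invertible[OF hermitian_metric_local(2)[OF \<omega> cd(2)]])
    have "\<forall>c\<in>A. \<forall>d\<in>A. \<forall>p\<in>fst c \<inter> fst d. \<forall>i j. \<omega> c (snd c p) $ i $ j =
        (\<Sum>k\<in>UNIV. \<Sum>l\<in>UNIV. dz i (\<lambda>z. transition c d z $ k) (snd c p) *
            cnj (dz j (\<lambda>z. transition c d z $ l) (snd c p)) * \<omega> d (snd d p) $ k $ l)"
      using \<omega> unfolding hermitian_metric_def by (rule conjunct2)
    from this[rule_format, OF cd(2,1)]
    show "\<omega> d ?z $ i $ j = (\<Sum>k\<in>UNIV. \<Sum>l\<in>UNIV. dz i (\<lambda>z. transition d c z $ k) ?z *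
        cnj (dz j (\<lambda>z. transition d c z $ l) ?z) * \<omega> c (snd c x) $ k $ l)" for i j
      using cd by simp
  qed
  finally show ?thesis .
qed

section \<open>An obstruction by the maximum principle\<close>

lemma smooth_fun_continuous_on:
  assumes "smooth_fun A u"
  shows "continuous_on UNIV u"
proof (rule continuous_at_imp_continuous_on, rule ballI)
  fix x
  define c where "c = chart_at A x"
  note c = chart_at[OF A, of x, folded c_def]
  have "continuous_on (chart_image c) (u \<circ> chart_inv c)"
    using assms c(1) unfolding smooth_fun_def by (blast intro: smooth_on_imp_continuous_on)
  then have "continuous_on (fst c) (\<lambda>x. (u \<circ> chart_inv c) (snd c x))"
    by (rule continuous_on_compose2) (use complex_atlas_chart(3)[OF A c(1)] in \<open>auto simp: homeomorphism_def\<close>)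
  then have "continuous_on (fst c) u"
    by (rule continuous_on_eq) (simp add: chart_inv_left[OF A c(1)])
  then show "isCont u x"
    using c(2) complex_atlas_chart(1)[OF A c(1)] by (simp add: continuous_on_eq_continuous_at)
qed

text \<open>Convexity of the exponential function turns a local maximum of \<open>v - f\<close>, where \<open>v = exp(-2u/n)\<close>,
  into a local maximum of \<open>- (2/n) v(x) u - f\<close>.\<close>

lemma chern_scalar_conformal_at_max:
  fixes u f :: "'a \<Rightarrow> real"
  defines "v \<equiv> \<lambda>x. exp (- 2 * u x / real CARD('n))"
  assumes \<omega>: "hermitian_metric A \<omega>" and u: "smooth_fun A u"
    and \<omega>': "\<forall>c\<in>A. \<forall>z\<in>chart_image c. \<omega>' c z = exp (2 * u (chart_inv c z) / real CARD('n)) *\<^sub>R \<omega> c z"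
    and d: "d = chart_at A x"
    and S: "open S" "snd d x \<in> S" "S \<subseteq> chart_image d" "smooth_on S (\<lambda>z. f (chart_inv d z))"
    and max: "\<And>z. z \<in> S \<Longrightarrow> v (chart_inv d z) - f (chart_inv d z) \<le> v x - f x"
  shows "- (2 / real CARD('n)) * (v x * chern_scalar A \<omega> x)
      - 2 * Re (levi_trace (\<omega> d) (\<lambda>z. f (chart_inv d z)) (snd d x))
    \<le> - (2 / real CARD('n)) * chern_scalar A \<omega>' x"
proof -
  let ?n = "real CARD('n)" and ?z = "snd d x"
  let ?u = "\<lambda>z. u (chart_inv d z)" and ?f = "\<lambda>z. f (chart_inv d z)"
  note dA = chart_at[OF A, of x, folded d]
  have n: "?n > 0" by simp
  have u': "smooth_on S ?u"
    using u dA(1) S(3) unfolding smooth_fun_def by (auto simp: comp_def intro: smooth_on_subset)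
  define a where "a = - (2 / ?n) * v x"
  have *: "a * ?u z + (- 1) * ?f z \<le> a * ?u ?z + (- 1) * ?f ?z" if z: "z \<in> S" for z
  proof -
    \<comment> \<open>The graph of the exponential lies above its tangent at u x, with equality at
      x, so passing to the linearisation of v preserves the maximum at x.\<close>
    have "v x * (1 + - 2 * (?u z - u x) / ?n) \<le> v x * exp (- 2 * (?u z - u x) / ?n)"
      by (intro mult_left_mono exp_ge_add_one_self) (simp add: v_def)
    also have "\<dots> = v (chart_inv d z)"
      by (simp add: v_def diff_divide_distrib right_diff_distrib flip: exp_add)
    finally have "v x * (1 + - 2 * (?u z - u x) / ?n) \<le> v x - f x + ?f z"
      using max[OF z] by simp
    moreover have "v x * (1 + - 2 * (?u z - u x) / ?n) = v x + (a * ?u z - a * u x)"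
      using n by (simp add: a_def field_simps)
    ultimately show ?thesis
      unfolding chart_inv_left[OF A dA] by simp
  qed
  have "Re (levi_trace (\<omega> d) (\<lambda>z. a * ?u z + (- 1) * ?f z) ?z) \<le> 0"
  proof (rule Re_levi_trace_nonpos_at_max[where f="\<lambda>z. a * ?u z + (- 1) * ?f z", OF _ S(1) _ S(2) *])
    show "hermitian_posdef (\<omega> d ?z)"
      using S by (intro hermitian_metric_local(2)[OF \<omega> dA(1)]) auto
    show "smooth_on S (\<lambda>z. a * ?u z + (- 1) * ?f z)"
      by (intro smooth_on_add smooth_on_mult smooth_on_const S u')
  qed
  then have "a * Re (levi_trace (\<omega> d) ?u ?z) \<le> Re (levi_trace (\<omega> d) ?f ?z)"
    unfolding levi_trace_linear[OF S(1) u' S(4,2)] by simp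
  moreover have eq: "chern_scalar A \<omega>' x = v x * (chern_scalar A \<omega> x - 2 * Re (levi_trace (\<omega> d) ?u ?z))"
    unfolding v_def d by (rule chern_scalar_conformal[OF A \<omega> u \<omega>'])
  have "- (2 / ?n) * chern_scalar A \<omega>' x
      = - (2 / ?n) * (v x * chern_scalar A \<omega> x) - 2 * (a * Re (levi_trace (\<omega> d) ?u ?z))"
    unfolding eq by (simp add: a_def algebra_simps)
  ultimately show ?thesis
    by linarith
qed

text \<open>The threshold n C / 2 for g comes from the maximum of v - |z - z0|^2: there -(2/n) s v
  is at most C - (2/n) g, which must not be positive. The lower bound s r^2 on all of the manifold
  only serves to bound v by the boundary value r^2 of the comparison function.\<close>

lemma not_conformal_chern_scalar:
  fixes z0 :: "complex^'n" and g :: "'a \<Rightarrow> real"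
  assumes cpt: "compact (UNIV :: 'a set)" and \<omega>: "hermitian_metric A \<omega>"
    and s: "\<And>x. chern_scalar A \<omega> x = s" "s < 0"
    and c: "c \<in> A" "0 < r" "cball z0 r \<subseteq> chart_image c"
    and C: "\<And>z. z \<in> cball z0 r \<Longrightarrow> 2 * Re (\<Sum>k\<in>UNIV. metric_inv (\<omega> c) z k k) \<le> C"
    and g: "\<And>x. s * r\<^sup>2 \<le> g x"
      "\<And>x. x \<in> fst c \<Longrightarrow> snd c x \<in> cball z0 r \<Longrightarrow> real CARD('n) / 2 * C \<le> g x"
  shows "\<not> (\<exists>\<omega>'. conformal A \<omega> \<omega>' \<and> (\<forall>x. chern_scalar A \<omega>' x = g x))"
proof
  assume "\<exists>\<omega>'. conformal A \<omega> \<omega>' \<and> (\<forall>x. chern_scalar A \<omega>' x = g x)"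
  then obtain \<omega>' u where u: "smooth_fun A u"
    and \<omega>': "\<forall>c\<in>A. \<forall>z\<in>chart_image c. \<omega>' c z = exp (2 * u (chart_inv c z) / real CARD('n)) *\<^sub>R \<omega> c z"
    and gS: "\<And>x. chern_scalar A \<omega>' x = g x"
    unfolding conformal_def by auto
  let ?n = "real CARD('n)"
  have n: "?n > 0" by simp
  define v where "v x = exp (- 2 * u x / ?n)" for x
  define q where "q x = (norm (snd c x - z0))\<^sup>2" for x
  have v: "0 < v x" for x
    by (simp add: v_def)
  have cont_v: "continuous_on S v" for S
    unfolding v_def
    by (intro continuous_intros continuous_on_subset[OF smooth_fun_continuous_on[OF u]]) auto
  note at_max = chern_scalar_conformal_at_max[OF \<omega> u \<omega>', folded v_def, unfolded gS s(1)]
  have v_le: "v y \<le> r\<^sup>2" for y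
  proof -
    obtain x where x: "\<And>y. v y \<le> v x"
      using continuous_attains_sup[OF cpt _ cont_v] by auto
    note d = chart_at[OF A, of x]
    \<comment> \<open>Comparison function 0 on the whole chart: at a maximum of v the Levi term
      disappears and s v >= g remains. Dividing by s < 0 later reverses the inequality.\<close>
    have "- (2 / ?n) * (v x * s) - 2 * Re (levi_trace (\<omega> (chart_at A x)) (\<lambda>z. 0) (snd (chart_at A x) x)) \<le> - (2 / ?n) * g x"
      using d x by (intro at_max[where f="\<lambda>_. 0" and S="chart_image (chart_at A x)", OF refl])
        (auto intro: smooth_on_const complex_atlas_chart(2)[OF A])
    then have "g x \<le> v x * s"
      using n by (simp add: levi_trace_const field_simps)
    then have "s * r\<^sup>2 \<le> s * v x"
      using g(1)[of x] by (simp add: mult.commute)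
    then show ?thesis
      using s(2) x[of y] by simp
  qed
  let ?B = "chart_inv c ` cball z0 r"
  have hom: "homeomorphism (fst c) (chart_image c) (snd c) (chart_inv c)"
    by (rule complex_atlas_chart(3)[OF A c(1)])
  have B: "?B \<subseteq> fst c"
    using c(3) chart_inv_in[OF A c(1)] by auto
  have "compact ?B"
    using hom c(3) by (intro compact_continuous_image compact_cball) (auto simp: homeomorphism_def intro: continuous_on_subset)
  moreover have "?B \<noteq> {}"
    using c(2) by simp
  moreover have "continuous_on ?B (\<lambda>x. v x - q x)"
    unfolding q_def using hom B
    by (intro continuous_intros cont_v) (auto simp: homeomorphism_def intro: continuous_on_subset)
  ultimately have "\<exists>x\<in>?B. \<forall>y\<in>?B. v y - q y \<le> v x - q x"
    by (rule continuous_attains_sup)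
  then obtain x where x: "x \<in> ?B" "\<And>y. y \<in> ?B \<Longrightarrow> v y - q y \<le> v x - q x"
    by blast
  have z0: "z0 \<in> chart_image c"
    using c(2,3) by auto
  \<comment> \<open>q vanishes at the centre, so the maximum of v - q is positive. Together with v
    <= r^2 this makes q x < r^2 strict and keeps x off the boundary.\<close>
  have "v (chart_inv c z0) - q (chart_inv c z0) \<le> v x - q x"
    using c(2) by (intro x(2)) simp
  then have "q x < r\<^sup>2"
    using v[of "chart_inv c z0"] v_le[of x] by (simp add: q_def chart_inv_right[OF A c(1) z0])
  then have x_ball: "snd c x \<in> ball z0 r"
    using c(2) power_less_imp_less_base[of "norm (snd c x - z0)" 2 r]
    by (simp add: q_def dist_norm norm_minus_commute)
  define d where "d = chart_at A x"
  note d = chart_at[OF A, of x, folded d_def]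
  have xc: "x \<in> fst c"
    using x(1) B by auto
  \<comment> \<open>A neighbourhood of x in the manifold rather than in coordinates: the maximum has
    to be read in the chart d that \<open>chart_at\<close> assigns to x, which may differ from
    c.\<close>
  define W where "W = fst c \<inter> snd c -` ball z0 r"
  have W: "open W" "W \<subseteq> ?B"
  proof -
    show "open W"
      unfolding W_def using hom
      by (intro continuous_open_preimage complex_atlas_chart(1)[OF A c(1)]) (auto simp: homeomorphism_def)
    show "W \<subseteq> ?B"
    proof
      fix y assume "y \<in> W"
      then show "y \<in> ?B"
        by (intro image_eqI[of _ _ "snd c y"]) (auto simp: W_def chart_inv_left[OF A c(1)])
    qed
  qed
  have "- (2 / ?n) * (v x * s) - 2 * Re (levi_trace (\<omega> d) (\<lambda>z. q (chart_inv d z)) (snd d x)) \<le> - (2 / ?n) * g x"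
  proof (rule at_max[OF d_def, of "snd d ` (fst d \<inter> W)"])
    show "open (snd d ` (fst d \<inter> W))"
      by (rule open_chart_image_Int[OF A d(1) W(1)])
    show "snd d x \<in> snd d ` (fst d \<inter> W)"
      using d(2) xc x_ball by (auto simp: W_def)
    show "smooth_on (snd d ` (fst d \<inter> W)) (\<lambda>z. q (chart_inv d z))"
      unfolding q_def by (rule smooth_on_subset[OF smooth_on_coordinate_distance[OF c(1) d(1)]]) (auto simp: W_def)
    fix z assume "z \<in> snd d ` (fst d \<inter> W)"
    then have "chart_inv d z \<in> W"
      using chart_inv_left[OF A d(1)] by auto
    then show "v (chart_inv d z) - q (chart_inv d z) \<le> v x - q x"
      using x(2) W(2) by blast
  qed auto
  also have "Re (levi_trace (\<omega> d) (\<lambda>z. q (chart_inv d z)) (snd d x)) = Re (\<Sum>k\<in>UNIV. metric_inv (\<omega> c) (snd c x) k k)"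
    unfolding q_def by (subst levi_trace_coordinate_distance[OF \<omega> c(1) d(1) xc d(2)]) (rule refl)
  finally have 1: "- (2 / ?n) * (v x * s) \<le> 2 * Re (\<Sum>k\<in>UNIV. metric_inv (\<omega> c) (snd c x) k k) - (2 / ?n) * g x"
    by simp
  have "2 * Re (\<Sum>k\<in>UNIV. metric_inv (\<omega> c) (snd c x) k k) \<le> C"
    using x_ball by (intro C) auto
  moreover have "C \<le> (2 / ?n) * g x"
    using g(2)[OF xc] x_ball n by (simp add: field_simps)
  ultimately have "- (2 / ?n) * (v x * s) \<le> 0"
    using 1 by linarith
  moreover have "0 < - (2 / ?n) * (v x * s)"
    using v[of x] s(2) n by (simp add: mult_pos_neg divide_neg_pos)
  ultimately show False
    by linarith
qed

end

section \<open>Bump functions and partitions of unity\<close>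

text \<open>The constant 4 puts the edge of the support at distance 2 r from z0.\<close>

definition bump :: "('a, 'n::finite) chart \<Rightarrow> complex^'n \<Rightarrow> real \<Rightarrow> 'a \<Rightarrow> real" where
  "bump c z0 r x = (if x \<in> fst c then flat 0 (4 - (norm (snd c x - z0))\<^sup>2 / r\<^sup>2) else 0)"

lemma bump_nonneg: "0 \<le> bump c z0 r x"
  and bump_le_1: "bump c z0 r x \<le> 1"
  by (simp_all add: bump_def flat_nonneg flat_0_le_1)

lemma bump_nonzeroD:
  assumes "bump c z0 r x \<noteq> 0" "0 < r"
  shows "x \<in> fst c" "norm (snd c x - z0) < 2 * r"
proof -
  show "x \<in> fst c"
    using assms(1) by (auto simp: bump_def split: if_splits)
  with assms have "(norm (snd c x - z0))\<^sup>2 / r\<^sup>2 < 4"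
    by (auto simp: bump_def flat_def split: if_splits)
  then have "(norm (snd c x - z0))\<^sup>2 < (2 * r)\<^sup>2"
    using assms(2) by (simp add: field_simps)
  then show "norm (snd c x - z0) < 2 * r"
    using assms(2) by (intro power_less_imp_less_base[of _ 2 "2 * r"]) auto
qed

text \<open>Within distance r the argument of \<open>flat\<close> is at least 3; the cruder bound 1
  already gives exp(-1).\<close>

lemma bump_ge:
  assumes "x \<in> fst c" "snd c x \<in> cball z0 r" "0 < r"
  shows "exp (- 1) \<le> bump c z0 r x"
proof -
  have "(norm (snd c x - z0))\<^sup>2 \<le> r\<^sup>2"
    using assms by (intro power_mono) (auto simp: dist_norm norm_minus_commute)
  then have "(norm (snd c x - z0))\<^sup>2 / r\<^sup>2 \<le> 1"
    using assms(3) by simp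
  then have "1 \<le> 4 - (norm (snd c x - z0))\<^sup>2 / r\<^sup>2"
    by linarith
  then show ?thesis
    using assms(1) by (simp add: bump_def flat_def field_simps)
qed

context
  fixes A :: "('a::{t2_space,second_countable_topology}, 'n::finite) chart set"
  assumes A: "complex_atlas A"
begin

lemma compact_chart_inv_image:
  assumes "c \<in> A" "compact K" "K \<subseteq> chart_image c"
  shows "compact (chart_inv c ` K)" "chart_inv c ` K \<subseteq> fst c"
proof -
  show "compact (chart_inv c ` K)"
    using complex_atlas_chart(3)[OF A assms(1)] assms
    by (intro compact_continuous_image) (auto simp: homeomorphism_def intro: continuous_on_subset)
  show "chart_inv c ` K \<subseteq> fst c"
    using assms(3) chart_inv_in[OF A assms(1)] by auto
qed

lemma bump_support:
  assumes "c \<in> A" "0 < r"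
  shows "{x. bump c z0 r x \<noteq> 0} \<subseteq> chart_inv c ` cball z0 (2 * r)"
proof
  fix x assume "x \<in> {x. bump c z0 r x \<noteq> 0}"
  then have x: "x \<in> fst c" "norm (snd c x - z0) < 2 * r"
    using bump_nonzeroD[of c z0 r x] assms(2) by auto
  then show "x \<in> chart_inv c ` cball z0 (2 * r)"
    by (intro image_eqI[of _ _ "snd c x"]) (auto simp: chart_inv_left[OF A assms(1)] dist_norm norm_minus_commute)
qed

text \<open>In a chart d the bump is a smooth composition on the overlap S1 with c, and zero on S2,
  outside the compact image of the closed ball. That image is closed in a Hausdorff space and lies
  inside the domain of c, so S1 and S2 are open and cover d.\<close>

lemma smooth_bump:
  assumes c: "c \<in> A" and r: "0 < r" "cball z0 (2 * r) \<subseteq> chart_image c"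
  shows "smooth_fun A (bump c z0 r)"
  unfolding smooth_fun_def
proof
  fix d assume d: "d \<in> A"
  let ?B = "chart_inv c ` cball z0 (2 * r)"
  define S1 where "S1 = snd d ` (fst d \<inter> fst c)"
  define S2 where "S2 = snd d ` (fst d \<inter> - ?B)"
  have "closed ?B"
    using compact_chart_inv_image(1)[OF c _ r(2)] by (simp add: compact_imp_closed)
  then have open_S: "open S1" "open S2"
    unfolding S1_def S2_def
    using open_chart_image_Int[OF A d] complex_atlas_chart(1)[OF A c] by auto
  have un: "chart_image d = S1 \<union> S2"
  proof -
    have "fst d = (fst d \<inter> fst c) \<union> (fst d \<inter> - ?B)"
      using compact_chart_inv_image(2)[OF c compact_cball r(2)] by blast
    then show ?thesis
      unfolding S1_def S2_def image_Un[symmetric] by (rule arg_cong)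
  qed
  have "smooth_on S1 (\<lambda>z. 4 - (norm (snd c (chart_inv d z) - z0))\<^sup>2 * inverse (r\<^sup>2))"
    by (intro smooth_on_diff smooth_on_mult smooth_on_const open_S
        smooth_on_coordinate_distance[OF A c d, folded S1_def])
  from smooth_on_flat_comp[OF open_S(1) this]
  have "smooth_on S1 (bump c z0 r \<circ> chart_inv d)"
    by (rule smooth_on_cong[OF open_S(1), rotated])
      (auto simp: bump_def S1_def chart_inv_left[OF A d] divide_inverse)
  moreover have "smooth_on S2 (bump c z0 r \<circ> chart_inv d)"
  proof (rule smooth_on_cong[OF open_S(2) _ smooth_on_const[OF open_S(2), of 0]])
    fix z assume "z \<in> S2"
    then have "chart_inv d z \<notin> ?B"
      unfolding S2_def using chart_inv_left[OF A d] by auto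
    then show "0 = (bump c z0 r \<circ> chart_inv d) z"
      using bump_support[OF c r(1), of z0] by auto
  qed
  ultimately show "smooth_on (chart_image d) (bump c z0 r \<circ> chart_inv d)"
    unfolding un by (rule smooth_on_Un[OF open_S])
qed

lemma cball_in_chart:
  assumes "c \<in> A" "p \<in> fst c"
  shows "\<exists>r>0. cball (snd c p) (2 * r) \<subseteq> chart_image c"
proof -
  obtain e where "0 < e" "cball (snd c p) e \<subseteq> chart_image c"
    using complex_atlas_chart(2)[OF A assms(1)] assms(2) open_contains_cball by (metis imageI)
  then show ?thesis
    by (intro exI[of _ "e / 2"]) auto
qed

text \<open>Without existence nothing would be known about the partition chosen in
  \<open>vol_integral\<close>. Finitely many bumps have positive sum by compactness; dividing by the
  sum keeps the supports, which lie in compact parts of chart domains.\<close>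

lemma partition_of_unity_exists:
  assumes cpt: "compact (UNIV :: 'a set)"
  shows "\<exists>P. partition_of_unity A P"
proof -
  define R where "R p = (SOME r. 0 < r \<and> cball (snd (chart_at A p) p) (2 * r) \<subseteq> chart_image (chart_at A p))" for p
  have "\<exists>r. 0 < r \<and> cball (snd (chart_at A p) p) (2 * r) \<subseteq> chart_image (chart_at A p)" for p
    using cball_in_chart[OF chart_at[OF A]] by blast
  from someI_ex[OF this] have R: "0 < R p" "cball (snd (chart_at A p) p) (2 * R p) \<subseteq> chart_image (chart_at A p)" for p
    unfolding R_def by auto
  define \<beta> where "\<beta> p = bump (chart_at A p) (snd (chart_at A p) p) (R p)" for p
  have cont: "continuous_on UNIV (\<beta> p)" for p
    unfolding \<beta>_def by (rule smooth_fun_continuous_on[OF A smooth_bump[OF chart_at(1)[OF A] R]])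
  have nonneg: "0 \<le> \<beta> p x" for p x
    by (simp add: \<beta>_def bump_nonneg)
  have pos: "0 < \<beta> p p" for p
    by (simp add: \<beta>_def bump_def flat_def chart_at(2)[OF A])
  have supp: "closure {x. \<beta> p x \<noteq> 0} \<subseteq> fst (chart_at A p)" for p
  proof -
    let ?B = "chart_inv (chart_at A p) ` cball (snd (chart_at A p) p) (2 * R p)"
    note B = compact_chart_inv_image[OF chart_at(1)[OF A] compact_cball R(2), of p]
    have "closure {x. \<beta> p x \<noteq> 0} \<subseteq> ?B"
      unfolding \<beta>_def by (rule closure_minimal[OF bump_support[OF chart_at(1)[OF A] R(1)] compact_imp_closed[OF B(1)]])
    with B(2) show ?thesis by blast
  qed
  have "open {x. 0 < \<beta> p x}" for p
    by (rule open_Collect_less[OF continuous_on_const cont])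
  moreover have "UNIV \<subseteq> (\<Union>p\<in>UNIV. {x. 0 < \<beta> p x})"
    using pos by auto
  ultimately obtain F where F: "finite F" "UNIV \<subseteq> (\<Union>p\<in>F. {x. 0 < \<beta> p x})"
    using compactE_image[OF cpt, of UNIV "\<lambda>p. {x. 0 < \<beta> p x}"] by metis
  obtain ps where ps: "set ps = F" "distinct ps"
    using finite_distinct_list[OF F(1)] by blast
  define \<sigma> where "\<sigma> x = (\<Sum>p\<in>F. \<beta> p x)" for x
  have \<sigma>: "0 < \<sigma> x" for x
  proof -
    obtain p where "p \<in> F" "0 < \<beta> p x"
      using F(2) by auto
    then show ?thesis
      unfolding \<sigma>_def using F(1) nonneg by (intro sum_pos2) auto
  qed
  define P where "P = map (\<lambda>p. (chart_at A p, \<lambda>x. \<beta> p x / \<sigma> x)) ps"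
  have "partition_of_unity A P"
    unfolding partition_of_unity_def
  proof (intro conjI allI ballI)
    fix x
    have "(\<Sum>(c, \<rho>)\<leftarrow>P. \<rho> x) = (\<Sum>p\<leftarrow>ps. \<beta> p x / \<sigma> x)"
      by (simp add: P_def comp_def)
    also have "\<dots> = (\<Sum>p\<in>F. \<beta> p x / \<sigma> x)"
      using ps by (simp add: sum_list_distinct_conv_sum_set)
    also have "\<dots> = 1"
      using \<sigma>[of x] by (simp add: \<sigma>_def flip: sum_divide_distrib)
    finally show "(\<Sum>(c, \<rho>)\<leftarrow>P. \<rho> x) = 1" .
  next
    fix c\<rho> assume "c\<rho> \<in> set P"
    then obtain p where p: "c\<rho> = (chart_at A p, \<lambda>x. \<beta> p x / \<sigma> x)"
      by (auto simp: P_def)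
    have "continuous_on UNIV (\<lambda>x. \<beta> p x / \<sigma> x)"
      unfolding \<sigma>_def using \<sigma>[unfolded \<sigma>_def] by (intro continuous_intros cont) (metis less_irrefl)
    moreover have "\<beta> p x / \<sigma> x \<noteq> 0 \<longleftrightarrow> \<beta> p x \<noteq> 0" for x
      using \<sigma>[of x] by simp
    ultimately show "case c\<rho> of (c, \<rho>) \<Rightarrow> c \<in> A \<and> continuous_on UNIV \<rho> \<and> (\<forall>p. 0 \<le> \<rho> p) \<and>
        closure {p. \<rho> p \<noteq> 0} \<subseteq> fst c"
      using chart_at(1)[OF A] supp[of p] nonneg \<sigma> unfolding p by (simp add: divide_nonneg_pos)
  qed
  then show ?thesis ..
qed

end

section \<open>The volume integral\<close>

text \<open>The integrand of one summand of \<open>vol_integral\<close>, with the indicator of the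
  chart image absorbed so that it is a function on all of coordinate space.\<close>

definition chart_density :: "('a, 'n::finite) metric \<Rightarrow> ('a, 'n) chart \<Rightarrow> ('a \<Rightarrow> real) \<Rightarrow> ('a \<Rightarrow> real) \<Rightarrow> complex^'n \<Rightarrow> real" where
  "chart_density \<omega> c \<rho> f z = indicator (chart_image c) z *
     (\<rho> (chart_inv c z) * f (chart_inv c z) * (2 ^ CARD('n) * Re (det (\<omega> c z))))"

lemma chart_density_linear:
  "chart_density \<omega> c \<rho> (\<lambda>x. a * f x + b * g x) z = a * chart_density \<omega> c \<rho> f z + b * chart_density \<omega> c \<rho> g z"
  by (simp add: chart_density_def algebra_simps)

lemma vol_integral_eq:
  "vol_integral A \<omega> f = (\<Sum>(c, \<rho>)\<leftarrow>(SOME P. partition_of_unity A P). integral\<^sup>L lborel (chart_density \<omega> c \<rho> f))"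
  by (simp add: vol_integral_def set_lebesgue_integral_def chart_density_def[abs_def])

lemma partition_of_unity_member:
  assumes "partition_of_unity A P" "(c, \<rho>) \<in> set P"
  shows "c \<in> A" "continuous_on UNIV \<rho>" "0 \<le> \<rho> x" "closure {p. \<rho> p \<noteq> 0} \<subseteq> fst c"
  using assms unfolding partition_of_unity_def by auto

lemma SOME_partition_of_unity:
  fixes A :: "('a::{t2_space,second_countable_topology}, 'n::finite) chart set"
  assumes "complex_atlas A" "compact (UNIV :: 'a set)"
  shows "partition_of_unity A (SOME P. partition_of_unity A P)"
  using partition_of_unity_exists[OF assms] by (rule someI_ex)

context
  fixes A :: "('a::{t2_space,second_countable_topology}, 'n::finite) chart set" and \<omega>
  assumes A: "complex_atlas A" and cpt: "compact (UNIV :: 'a set)" and \<omega>: "hermitian_metric A \<omega>"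
begin

lemma continuous_on_det_metric: "c \<in> A \<Longrightarrow> continuous_on (chart_image c) (\<lambda>z. Re (det (\<omega> c z)))"
  unfolding det_def
  by (intro continuous_intros smooth_on_imp_continuous_on[OF hermitian_metric_local(1)[OF \<omega>]])

lemma continuous_on_chart_density:
  assumes "c \<in> A" "continuous_on UNIV \<rho>" "continuous_on UNIV f"
  shows "continuous_on (chart_image c) (chart_density \<omega> c \<rho> f)"
proof -
  have inv: "continuous_on (chart_image c) (chart_inv c)"
    using complex_atlas_chart(3)[OF A assms(1)] by (simp add: homeomorphism_def)
  have "continuous_on (chart_image c)
      (\<lambda>z. \<rho> (chart_inv c z) * f (chart_inv c z) * (2 ^ CARD('n) * Re (det (\<omega> c z))))"
    by (intro continuous_on_mult continuous_on_const continuous_on_det_metric assms(1)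
        continuous_on_compose2[OF assms(2) inv] continuous_on_compose2[OF assms(3) inv]) auto
  then show ?thesis
    by (rule continuous_on_eq) (simp add: chart_density_def)
qed

lemma compact_chart_support:
  assumes c: "c \<in> A" and supp: "closure {p. \<rho> p \<noteq> 0} \<subseteq> fst c"
  shows "compact (snd c ` closure {p. \<rho> p \<noteq> 0})" "snd c ` closure {p. \<rho> p \<noteq> 0} \<subseteq> chart_image c"
    "z \<notin> snd c ` closure {p. \<rho> p \<noteq> 0} \<Longrightarrow> chart_density \<omega> c \<rho> f z = 0"
proof -
  let ?Z = "closure {p. \<rho> p \<noteq> 0}"
  have "compact ?Z"
    using compact_Int_closed[OF cpt closed_closure, of "{p. \<rho> p \<noteq> 0}"] by simp
  moreover have "continuous_on ?Z (snd c)"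
    using complex_atlas_chart(3)[OF A c] supp by (auto simp: homeomorphism_def intro: continuous_on_subset)
  ultimately show "compact (snd c ` ?Z)"
    by (rule compact_continuous_image[rotated])
  show "snd c ` ?Z \<subseteq> chart_image c"
    using supp by auto
  assume z: "z \<notin> snd c ` ?Z"
  show "chart_density \<omega> c \<rho> f z = 0"
  proof (cases "z \<in> chart_image c \<and> \<rho> (chart_inv c z) \<noteq> 0")
    case True
    then have "chart_inv c z \<in> ?Z"
      by (auto intro: closure_subset[THEN subsetD])
    then have "snd c (chart_inv c z) \<in> snd c ` ?Z"
      by (rule imageI)
    then show ?thesis
      using z True by (simp add: chart_inv_right[OF A c])
  qed (auto simp: chart_density_def)
qed

text \<open>The metric may be unbounded towards the edge of a chart image. The partition function
  confines the integrand to a compact subset, on which it is continuous.\<close>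

lemma integrable_chart_density:
  assumes c: "c \<in> A" and \<rho>: "continuous_on UNIV \<rho>" "closure {p. \<rho> p \<noteq> 0} \<subseteq> fst c"
    and f: "continuous_on UNIV f"
  shows "integrable lborel (chart_density \<omega> c \<rho> f)"
proof -
  let ?K = "snd c ` closure {p. \<rho> p \<noteq> 0}"
  note K = compact_chart_support[OF c \<rho>(2)]
  have "integrable lborel (\<lambda>z. indicator ?K z *\<^sub>R chart_density \<omega> c \<rho> f z)"
    by (intro borel_integrable_compact K(1) continuous_on_subset[OF continuous_on_chart_density[OF c \<rho>(1) f] K(2)])
  moreover have "indicator ?K z *\<^sub>R chart_density \<omega> c \<rho> f z = chart_density \<omega> c \<rho> f z" for z
    using K(3)[of z f] by (cases "z \<in> ?K") auto
  ultimately show ?thesis by (simp only:)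
qed

lemma vol_integral_linear:
  assumes "continuous_on UNIV f" "continuous_on UNIV g"
  shows "vol_integral A \<omega> (\<lambda>x. a * f x + b * g x) = a * vol_integral A \<omega> f + b * vol_integral A \<omega> g"
proof -
  define P where "P = (SOME P. partition_of_unity A P)"
  have P: "partition_of_unity A P"
    unfolding P_def by (rule SOME_partition_of_unity[OF A cpt])
  have *: "integral\<^sup>L lborel (chart_density \<omega> c \<rho> (\<lambda>x. a * f x + b * g x)) =
      a * integral\<^sup>L lborel (chart_density \<omega> c \<rho> f) + b * integral\<^sup>L lborel (chart_density \<omega> c \<rho> g)"
    if "(c, \<rho>) \<in> set P" for c \<rho>
    using integrable_chart_density[OF partition_of_unity_member(1,2,4)[OF P that]] assms
    by (simp add: chart_density_linear[abs_def])
  \<comment> \<open>Induction over lists with entries from P, so that the facts about members of the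
    partition remain available.\<close>
  have "(\<Sum>(c, \<rho>)\<leftarrow>Q. integral\<^sup>L lborel (chart_density \<omega> c \<rho> (\<lambda>x. a * f x + b * g x))) =
      a * (\<Sum>(c, \<rho>)\<leftarrow>Q. integral\<^sup>L lborel (chart_density \<omega> c \<rho> f))
      + b * (\<Sum>(c, \<rho>)\<leftarrow>Q. integral\<^sup>L lborel (chart_density \<omega> c \<rho> g))"
    if "set Q \<subseteq> set P" for Q
    using that by (induction Q) (auto simp: * algebra_simps)
  from this[OF order_refl] show ?thesis
    unfolding vol_integral_eq P_def .
qed

lemma chart_density_nonneg:
  assumes "c \<in> A" "\<And>x. 0 \<le> \<rho> x"
  shows "0 \<le> chart_density \<omega> c \<rho> (\<lambda>_. 1) z"
proof (cases "z \<in> chart_image c")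
  case True
  then show ?thesis
    using hermitian_posdef_det_pos[OF hermitian_metric_local(2)[OF \<omega> assms(1) True]] assms(2)
    by (simp add: chart_density_def)
qed (simp add: chart_density_def)

text \<open>Some partition function is nonzero at a given point. There the density is positive and,
  by continuity, at least half that value on a small ball; all other summands are
  nonnegative.\<close>

lemma volume_pos: "0 < volume A \<omega>"
proof -
  define P where "P = (SOME P. partition_of_unity A P)"
  have P: "partition_of_unity A P"
    unfolding P_def by (rule SOME_partition_of_unity[OF A cpt])
  note mem = partition_of_unity_member[OF P]
  \<comment> \<open>An arbitrary point; one exists because types are inhabited.\<close>
  fix p :: 'a
  have "(\<Sum>(c, \<rho>)\<leftarrow>P. \<rho> p) = 1"
    using P unfolding partition_of_unity_def by blast
  moreover have "(\<Sum>(c, \<rho>)\<leftarrow>Q. \<rho> p) = 0" if "\<forall>(c, \<rho>)\<in>set Q. \<rho> p = 0" for Q :: "(('a, 'n) chart \<times> ('a \<Rightarrow> real)) list"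
    using that by (induction Q) auto
  ultimately obtain c \<rho> where c\<rho>: "(c, \<rho>) \<in> set P" "\<rho> p \<noteq> 0"
    by fastforce
  note c = mem(1,2,4)[OF c\<rho>(1)]
  let ?F = "chart_density \<omega> c \<rho> (\<lambda>_. 1)" and ?z = "snd c p"
  have pc: "p \<in> fst c"
    using c(3) c\<rho>(2) closure_subset[of "{p. \<rho> p \<noteq> 0}"] by auto
  then have z: "?z \<in> chart_image c"
    by simp
  have "0 < Re (det (\<omega> c ?z))"
    by (rule hermitian_posdef_det_pos[OF hermitian_metric_local(2)[OF \<omega> c(1) z]])
  then have F: "0 < ?F ?z"
    using c\<rho>(2) mem(3)[OF c\<rho>(1), of p] z by (simp add: chart_density_def chart_inv_left[OF A c(1) pc])
  have "isCont ?F ?z"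
    using continuous_on_chart_density[OF c(1,2), of "\<lambda>_. 1"] pc complex_atlas_chart(2)[OF A c(1)]
    by (simp add: continuous_on_eq_continuous_at)
  then obtain e where e: "0 < e" "\<And>z. dist z ?z < e \<Longrightarrow> dist (?F z) (?F ?z) < ?F ?z / 2"
    using F unfolding continuous_at_eps_delta by (meson half_gt_zero)
  have "0 < integral\<^sup>L lborel (\<lambda>z. indicator (ball ?z e) z * (?F ?z / 2))"
    using F content_ball_pos[OF e(1), of ?z] by simp
  also have "\<dots> \<le> integral\<^sup>L lborel ?F"
  proof (rule integral_mono)
    show "integrable lborel (\<lambda>z. indicator (ball ?z e) z * (?F ?z / 2))"
      by (intro integrable_mult_left integrable_real_indicator) (use emeasure_bounded_finite[OF bounded_ball, of ?z e] in auto)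
    show "integrable lborel ?F"
      by (rule integrable_chart_density[OF c continuous_on_const])
    fix z
    show "indicator (ball ?z e) z * (?F ?z / 2) \<le> ?F z"
    proof (cases "z \<in> ball ?z e")
      case True
      then have "dist (?F z) (?F ?z) < ?F ?z / 2"
        using e(2)[of z] by (simp add: dist_commute)
      then have "\<bar>?F z - ?F ?z\<bar> < ?F ?z / 2"
        by (simp only: dist_real_def)
      then have "?F ?z / 2 \<le> ?F z"
        by linarith
      then show ?thesis
        using True by simp
    next
      case False
      then show ?thesis
        using chart_density_nonneg[OF c(1) mem(3)[OF c\<rho>(1)]] by simp
    qed
  qed
  finally have pos: "0 < integral\<^sup>L lborel ?F" .
  let ?xs = "map (\<lambda>(c, \<rho>). integral\<^sup>L lborel (chart_density \<omega> c \<rho> (\<lambda>_. 1))) P"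
  have nonneg: "0 \<le> x" if "x \<in> set ?xs" for x
    using that mem(1,3) by (auto intro!: integral_nonneg_AE AE_I2 chart_density_nonneg)
  have "sum_list ?xs \<noteq> 0"
    using sum_list_nonneg_eq_0_iff[OF nonneg] pos c\<rho>(1) by force
  moreover have "0 \<le> sum_list ?xs"
    by (rule sum_list_nonneg) (rule nonneg)
  ultimately show ?thesis
    unfolding vol_integral_eq P_def[symmetric] by linarith
qed

end

lemma integrable_indicator_cball:
  "integrable lborel (\<lambda>z. M * indicator (cball z0 R) z :: real)" for z0 :: "'a::euclidean_space"
  using emeasure_bounded_finite[OF bounded_cball, of z0 R]
  by (intro integrable_mult_right integrable_real_indicator) auto

section \<open>Integrals of bump functions of small radius\<close>

context
  fixes A :: "('a::{t2_space,second_countable_topology}, 'n::finite) chart set" and \<omega>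
  assumes A: "complex_atlas A" and cpt: "compact (UNIV :: 'a set)" and \<omega>: "hermitian_metric A \<omega>"
begin

text \<open>Differentiability of the transition map at the centre alone shows that the support of a bump
  function of radius \<open>r\<close> lies in a ball of radius \<open>O(r)\<close> of any other chart.\<close>

lemma bump_support_other_chart:
  assumes c0: "c0 \<in> A" "p \<in> fst c0" and c: "c \<in> A" and Z: "closed Z" "Z \<subseteq> fst c"
  shows "\<exists>L>0. \<exists>r0>0. \<forall>r. 0 < r \<longrightarrow> r < r0 \<longrightarrow>
    (\<forall>x\<in>Z. bump c0 (snd c0 p) r x \<noteq> 0 \<longrightarrow> snd c x \<in> cball (snd c p) (L * r))"
proof (cases "p \<in> Z")
  \<comment> \<open>Small bumps around p do not meet the closed set Z, so any L will do.\<close>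
  case False
  have "open (snd c0 ` (fst c0 \<inter> - Z))"
    using Z(1) by (intro open_chart_image_Int[OF A c0(1)]) auto
  then obtain e where e: "0 < e" "ball (snd c0 p) e \<subseteq> snd c0 ` (fst c0 \<inter> - Z)"
    using False c0(2) open_contains_ball by (metis ComplI IntI imageI)
  have "bump c0 (snd c0 p) r x = 0" if r: "0 < r" "r < e / 2" and x: "x \<in> Z" for r x
  proof (rule ccontr)
    assume "bump c0 (snd c0 p) r x \<noteq> 0"
    then have x': "x \<in> fst c0" "norm (snd c0 x - snd c0 p) < 2 * r"
      using bump_nonzeroD[of c0 "snd c0 p" r x] r(1) by auto
    then have "snd c0 x \<in> ball (snd c0 p) e"
      using r by (simp add: dist_norm norm_minus_commute)
    then obtain y where "y \<in> fst c0" "y \<notin> Z" "snd c0 x = snd c0 y"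
      using e(2) by auto
    then have "x = y"
      using chart_inv_left[OF A c0(1)] x'(1) by metis
    then show False
      using x \<open>y \<notin> Z\<close> by simp
  qed
  then show ?thesis
    using e(1) by (intro exI[of _ 1] conjI exI[of _ "e / 2"]) auto
next
  case True
  let ?T = "transition c0 c" and ?z = "snd c0 p" and ?U = "snd c0 ` (fst c0 \<inter> fst c)"
  have z: "?z \<in> ?U"
    using c0(2) True Z(2) by auto
  have U: "open ?U"
    by (rule open_chart_image_Int[OF A c0(1) complex_atlas_chart(1)[OF A c]])
  have "holomorphic_map_on ?U ?T"
    using A c0(1) c unfolding complex_atlas_def by blast
  then obtain D where D: "(?T has_derivative D) (at ?z)"
    using z unfolding holomorphic_map_on_def by blast
  obtain K where K: "0 < K" "\<And>v. norm (D v) \<le> norm v * K"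
    using bounded_linear.pos_bounded[OF has_derivative_bounded_linear[OF D]] by auto
  \<comment> \<open>Tolerance 1 in the definition of the derivative gives |T w - T z| <= (K + 1) |w
    - z|. The support has |w - z| < 2 r, hence L = 2 (K + 1).\<close>
  obtain d where d: "0 < d" "\<And>w. norm (w - ?z) < d \<Longrightarrow> norm (?T w - ?T ?z - D (w - ?z)) \<le> 1 * norm (w - ?z)"
    using D[unfolded has_derivative_at_alt, THEN conjunct2, rule_format, of 1] by auto
  have T: "?T (snd c0 x) = snd c x" if "x \<in> fst c0" for x
    using that by (simp add: transition_def chart_inv_left[OF A c0(1)])
  have "snd c x \<in> cball (snd c p) (2 * (K + 1) * r)"
    if r: "0 < r" "r < d / 2" and x: "bump c0 ?z r x \<noteq> 0" for r x
  proof -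
    have x': "x \<in> fst c0" "norm (snd c0 x - ?z) < 2 * r"
      using bump_nonzeroD[OF x r(1)] by auto
    then have "norm (snd c0 x - ?z) < d"
      using r(2) by simp
    from d(2)[OF this] have "norm (snd c x - snd c p - D (snd c0 x - ?z)) \<le> norm (snd c0 x - ?z)"
      by (simp add: T x'(1) c0(2))
    then have "norm (snd c x - snd c p) \<le> norm (snd c0 x - ?z) + norm (D (snd c0 x - ?z))"
      using norm_triangle_sub[of "snd c x - snd c p" "D (snd c0 x - ?z)"] by simp
    also have "\<dots> \<le> norm (snd c0 x - ?z) * (K + 1)"
      using K(2)[of "snd c0 x - ?z"] by (simp add: algebra_simps)
    also have "\<dots> \<le> 2 * r * (K + 1)"
      using x'(2) K(1) by (intro mult_right_mono) auto
    finally show ?thesis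
      by (simp add: dist_norm norm_minus_commute mult_ac)
  qed
  then show ?thesis
    using K(1) d(1) by (intro exI[of _ "2 * (K + 1)"] conjI exI[of _ "d / 2"]) auto
qed

text \<open>The bump is at most 1, the density of f is bounded by M on the compact support of
  \<rho>, and the product lives on a ball of radius L r in real dimension 2n.\<close>

lemma bump_density_integral_bound:
  assumes c0: "c0 \<in> A" "p \<in> fst c0" and c: "c \<in> A"
    and \<rho>: "continuous_on UNIV \<rho>" "closure {p. \<rho> p \<noteq> 0} \<subseteq> fst c" and f: "continuous_on UNIV f"
  shows "\<exists>K\<ge>0. \<exists>r0>0. \<forall>r. 0 < r \<longrightarrow> r < r0 \<longrightarrow>
    \<bar>integral\<^sup>L lborel (chart_density \<omega> c \<rho> (\<lambda>x. bump c0 (snd c0 p) r x * f x))\<bar> \<le> K * r ^ (2 * CARD('n))"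
proof -
  let ?z = "snd c0 p" and ?Z = "closure {p. \<rho> p \<noteq> 0}"
  let ?g = "\<lambda>r x. bump c0 ?z r x * f x"
  obtain L r1 where L: "0 < L" "0 < r1"
    "\<And>r x. 0 < r \<Longrightarrow> r < r1 \<Longrightarrow> x \<in> ?Z \<Longrightarrow> bump c0 ?z r x \<noteq> 0 \<Longrightarrow> snd c x \<in> cball (snd c p) (L * r)"
    using bump_support_other_chart[OF c0 c closed_closure \<rho>(2)] by auto
  obtain r2 where r2: "0 < r2" "cball ?z (2 * r2) \<subseteq> chart_image c0"
    using cball_in_chart[OF A c0] by auto
  note K = compact_chart_support[OF A cpt \<omega> c \<rho>(2)]
  have "compact (chart_density \<omega> c \<rho> f ` (snd c ` ?Z))"
    by (rule compact_continuous_image[OF continuous_on_subset[OF continuous_on_chart_density[OF A cpt \<omega> c \<rho>(1) f] K(2)] K(1)])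
  from compact_imp_bounded[OF this]
  obtain M where M0: "0 < M" "\<forall>y\<in>chart_density \<omega> c \<rho> f ` (snd c ` ?Z). norm y \<le> M"
    unfolding bounded_pos by blast
  then have M: "0 < M" "\<And>z. z \<in> snd c ` ?Z \<Longrightarrow> \<bar>chart_density \<omega> c \<rho> f z\<bar> \<le> M"
    by auto
  have bound: "\<bar>chart_density \<omega> c \<rho> (?g r) z\<bar> \<le> M * indicator (cball (snd c p) (L * r)) z"
    if r: "0 < r" "r < r1" for r z
  proof (cases "z \<in> snd c ` ?Z \<and> bump c0 ?z r (chart_inv c z) \<noteq> 0")
    case True
    then obtain x where x: "x \<in> ?Z" "z = snd c x"
      by auto
    have "chart_inv c z = x"
      using x \<rho>(2) chart_inv_left[OF A c] by auto
    then have "z \<in> cball (snd c p) (L * r)"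
      using L(3)[OF r x(1)] True x(2) by auto
    moreover have "chart_density \<omega> c \<rho> (?g r) z = bump c0 ?z r (chart_inv c z) * chart_density \<omega> c \<rho> f z"
      by (simp add: chart_density_def)
    moreover have "bump c0 ?z r (chart_inv c z) * \<bar>chart_density \<omega> c \<rho> f z\<bar> \<le> 1 * M"
      using True M by (intro mult_mono bump_le_1) auto
    ultimately show ?thesis
      by (simp add: abs_mult bump_nonneg)
  next
    case False
    then have "chart_density \<omega> c \<rho> (?g r) z = 0"
      using K(3)[of z "?g r"] by (auto simp: chart_density_def)
    then show ?thesis
      using M(1) by simp
  qed
  define K where "K = M * (unit_ball_vol (real (2 * CARD('n))) * L ^ (2 * CARD('n)))"
  have "\<bar>integral\<^sup>L lborel (chart_density \<omega> c \<rho> (?g r))\<bar> \<le> K * r ^ (2 * CARD('n))"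
    if r: "0 < r" "r < min r1 r2" for r
  proof -
    have "cball ?z (2 * r) \<subseteq> chart_image c0"
      using r by (intro order_trans[OF subset_cball r2(2)]) auto
    from smooth_fun_continuous_on[OF A smooth_bump[OF A c0(1) r(1) this]]
    have "continuous_on UNIV (?g r)"
      using f by (intro continuous_intros)
    then have "norm (integral\<^sup>L lborel (chart_density \<omega> c \<rho> (?g r)))
        \<le> integral\<^sup>L lborel (\<lambda>z. M * indicator (cball (snd c p) (L * r)) z)"
      using bound[of r] r
      by (intro Bochner_Integration.integral_norm_bound_integral integrable_chart_density[OF A cpt \<omega> c \<rho>]
          integrable_indicator_cball) auto
    also have "\<dots> = M * measure lborel (cball (snd c p) (L * r))"
      by simp
    also have "\<dots> = K * r ^ (2 * CARD('n))"
      using L(1) r(1) by (simp add: content_cball K_def power_mult_distrib mult_ac)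
    finally show ?thesis
      by simp
  qed
  moreover have "0 \<le> K"
    using M(1) L(1) by (simp add: K_def)
  ultimately show ?thesis
    using L(2) r2(1) by (intro exI[of _ K] conjI exI[of _ "min r1 r2"]) auto
qed

lemma vol_integral_bump_bound:
  assumes c0: "c0 \<in> A" "p \<in> fst c0" and f: "continuous_on UNIV f"
  shows "\<exists>K\<ge>0. \<exists>r0>0. \<forall>r. 0 < r \<longrightarrow> r < r0 \<longrightarrow>
    \<bar>vol_integral A \<omega> (\<lambda>x. bump c0 (snd c0 p) r x * f x)\<bar> \<le> K * r ^ (2 * CARD('n))"
proof -
  define P where "P = (SOME P. partition_of_unity A P)"
  have P: "partition_of_unity A P"
    unfolding P_def by (rule SOME_partition_of_unity[OF A cpt])
  let ?g = "\<lambda>r x. bump c0 (snd c0 p) r x * f x" and ?N = "2 * CARD('n)"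
  have "\<exists>K\<ge>0. \<exists>r0>0. \<forall>r. 0 < r \<longrightarrow> r < r0 \<longrightarrow>
      \<bar>\<Sum>(c, \<rho>)\<leftarrow>Q. integral\<^sup>L lborel (chart_density \<omega> c \<rho> (?g r))\<bar> \<le> K * r ^ ?N"
    if "set Q \<subseteq> set P" for Q
    using that
  proof (induction Q)
    case Nil
    show ?case
      by (intro exI[of _ 0] conjI exI[of _ 1]) auto
  next
    case (Cons c\<rho> Q)
    obtain c \<rho> where c\<rho>: "c\<rho> = (c, \<rho>)"
      by (cases c\<rho>)
    have "(c, \<rho>) \<in> set P"
      using Cons.prems c\<rho> by simp
    from bump_density_integral_bound[OF c0 partition_of_unity_member(1,2,4)[OF P this] f]
    obtain K1 r1 where 1: "0 \<le> K1" "0 < r1" "\<And>r. 0 < r \<Longrightarrow> r < r1 \<Longrightarrow>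
        \<bar>integral\<^sup>L lborel (chart_density \<omega> c \<rho> (?g r))\<bar> \<le> K1 * r ^ ?N"
      by blast
    obtain K2 r2 where 2: "0 \<le> K2" "0 < r2" "\<And>r. 0 < r \<Longrightarrow> r < r2 \<Longrightarrow>
        \<bar>\<Sum>(c, \<rho>)\<leftarrow>Q. integral\<^sup>L lborel (chart_density \<omega> c \<rho> (?g r))\<bar> \<le> K2 * r ^ ?N"
      using Cons by auto
    have "\<bar>\<Sum>(c, \<rho>)\<leftarrow>c\<rho> # Q. integral\<^sup>L lborel (chart_density \<omega> c \<rho> (?g r))\<bar> \<le> (K1 + K2) * r ^ ?N"
      if "0 < r" "r < min r1 r2" for r
      using 1(3)[of r] 2(3)[of r] that abs_triangle_ineq[of "integral\<^sup>L lborel (chart_density \<omega> c \<rho> (?g r))"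
          "\<Sum>(c, \<rho>)\<leftarrow>Q. integral\<^sup>L lborel (chart_density \<omega> c \<rho> (?g r))"]
      by (simp add: c\<rho> distrib_right)
    then show ?case
      using 1(1,2) 2(1,2) by (intro exI[of _ "K1 + K2"] conjI exI[of _ "min r1 r2"]) auto
  qed
  from this[OF order_refl] show ?thesis
    unfolding vol_integral_eq P_def .
qed

end

section \<open>Choice of the radius and of the height of the bump\<close>

theorem corollary2p8:
  fixes A :: "('a::{t2_space,second_countable_topology}, 'n::finite) chart set"
    and \<omega> :: "('a, 'n) metric"
    and f0 :: "'a \<Rightarrow> real"
  assumes "complex_atlas A"
    and "compact (UNIV :: 'a set)"
    and "connected (UNIV :: 'a set)"
    and "CARD('n) \<ge> 2"
    and "hermitian_metric A \<omega>"
    and "\<forall>p. chern_scalar A \<omega> p = gauduchon_degree A \<omega>"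
    and "gauduchon_degree A \<omega> < 0"
    and "eccentricity_function A \<omega> f0"
  shows "\<exists>g. smooth_fun A g \<and>
             vol_integral A \<omega> (\<lambda>p. g p * f0 p) < 0 \<and>
             \<not> (\<exists>\<omega>'. conformal A \<omega> \<omega>' \<and> (\<forall>p. chern_scalar A \<omega>' p = g p))"
proof -
  note A = assms(1) and cpt = assms(2) and \<omega> = assms(5)
  define s where "s = gauduchon_degree A \<omega>"
  have s: "\<And>x. chern_scalar A \<omega> x = s" "s < 0"
    using assms(6,7) by (simp_all add: s_def)
  let ?n = "real CARD('n)"
  define V where "V = volume A \<omega>"
  have V: "0 < V" "vol_integral A \<omega> f0 = V"
    using volume_pos[OF A cpt \<omega>] assms(8) by (simp_all add: V_def eccentricity_function_def)
  have f0: "continuous_on UNIV f0"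
    using assms(8) by (auto simp: eccentricity_function_def intro: smooth_fun_continuous_on[OF A])
  fix p :: 'a
  define c where "c = chart_at A p"
  note c = chart_at[OF A, of p, folded c_def]
  define z0 where "z0 = snd c p"
  obtain r1 where r1: "0 < r1" "cball z0 (2 * r1) \<subseteq> chart_image c"
    using cball_in_chart[OF A c] unfolding z0_def by blast
  obtain K r2 where K: "0 \<le> K" "0 < r2" "\<And>r. 0 < r \<Longrightarrow> r < r2 \<Longrightarrow>
      \<bar>vol_integral A \<omega> (\<lambda>x. bump c z0 r x * f0 x)\<bar> \<le> K * r ^ (2 * CARD('n))"
    using vol_integral_bump_bound[OF A cpt \<omega> c f0] unfolding z0_def by blast
  have "(\<lambda>z. metric_inv (\<omega> c) z k k) differentiable (at z)" if z: "z \<in> chart_image c" for k z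
    unfolding metric_inv_def
    by (rule differentiable_matrix_inv[OF complex_atlas_chart(2)[OF A c(1)] z])
      (intro hermitian_posdef_invertible hermitian_metric_local(2)[OF \<omega> c(1)]
        smooth_on_differentiable[OF hermitian_metric_local(1)[OF \<omega> c(1)] z]; assumption)+
  then have "continuous_on (chart_image c) (\<lambda>z. metric_inv (\<omega> c) z k k)" for k
    by (intro continuous_at_imp_continuous_on ballI differentiable_imp_continuous_within)
  then have "continuous_on (cball z0 (2 * r1)) (\<lambda>z. 2 * Re (\<Sum>k\<in>UNIV. metric_inv (\<omega> c) z k k))"
    by (intro continuous_intros continuous_on_subset[OF _ r1(2)])
  then have "bounded ((\<lambda>z. 2 * Re (\<Sum>k\<in>UNIV. metric_inv (\<omega> c) z k k)) ` cball z0 (2 * r1))"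
    by (intro compact_imp_bounded compact_continuous_image compact_cball)
  then obtain C where C: "0 < C" "\<And>z. z \<in> cball z0 (2 * r1) \<Longrightarrow> 2 * Re (\<Sum>k\<in>UNIV. metric_inv (\<omega> c) z k k) \<le> C"
    unfolding bounded_pos by (fastforce simp: abs_le_iff)
  \<comment> \<open>The height \<open>e\<close> below evaluated at radius 1. It bounds
    \<open>e\<close> for all r <= 1, which allows r to be chosen before \<open>e\<close> is
    fixed.\<close>
  define E where "E = exp 1 * (?n / 2 * C - s)"
  have nC: "0 < ?n / 2 * C"
    using C(1) by simp
  have E: "0 < E"
    unfolding E_def using nC s(2) by (intro mult_pos_pos exp_gt_zero) linarith
  \<comment> \<open>In turn: the ball of radius 2 r stays in the chart, r < r2, higher powers of r
    decrease, and E K r is at most half of - s V. The + 1 keeps the denominator positive when K =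
    0.\<close>
  define r where "r = Min {r1, r2 / 2, 1, - s * V / (2 * (E * K + 1))}"
  have EK: "0 < E * K + 1"
    using E K(1) by (simp add: add_nonneg_pos)
  have r: "0 < r" "r \<le> r1" "r < r2" "r \<le> 1" "r \<le> - s * V / (2 * (E * K + 1))"
    using r1(1) K(2) mult_neg_pos[OF s(2) V(1)] EK unfolding r_def
    by (auto simp: divide_neg_pos min_less_iff_disj)
  \<comment> \<open>Solves e exp(-1) + s r^2 = n C / 2, where exp(-1) is the lower bound of the bump
    on the inner ball.\<close>
  define e where "e = exp 1 * (?n / 2 * C - s * r\<^sup>2)"
  have r2_le: "r\<^sup>2 \<le> 1"
    using r by (simp add: power_le_one)
  have e: "0 \<le> e" "e \<le> E"
  proof -
    have "s * r\<^sup>2 \<le> 0" "s \<le> s * r\<^sup>2"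
      using s(2) r2_le by (simp_all add: mult_nonpos_nonneg mult_le_cancel_left1)
    then show "0 \<le> e" "e \<le> E"
      unfolding e_def E_def using nC by (intro mult_nonneg_nonneg mult_left_mono exp_ge_zero; linarith)+
  qed
  define g where "g x = s * r\<^sup>2 * 1 + e * bump c z0 r x" for x
  have ball: "cball z0 (2 * r) \<subseteq> chart_image c"
    using r by (intro order_trans[OF subset_cball r1(2)]) auto
  note bump = smooth_bump[OF A c(1) r(1) ball]
  show ?thesis
  proof (intro exI[of _ g] conjI)
    show "smooth_fun A g"
      unfolding smooth_fun_def
    proof
      fix d assume d: "d \<in> A"
      have "smooth_on (chart_image d) (\<lambda>z. bump c z0 r (chart_inv d z))"
        using bump d by (simp add: smooth_fun_def comp_def)
      then have "smooth_on (chart_image d) (\<lambda>z. s * r\<^sup>2 + e * bump c z0 r (chart_inv d z))"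
        by (intro smooth_on_add smooth_on_mult smooth_on_const complex_atlas_chart(2)[OF A d])
      then show "smooth_on (chart_image d) (g \<circ> chart_inv d)"
        by (simp add: g_def comp_def)
    qed
    have "vol_integral A \<omega> (\<lambda>x. g x * f0 x) = vol_integral A \<omega> (\<lambda>x. s * r\<^sup>2 * f0 x + e * (bump c z0 r x * f0 x))"
      by (simp add: g_def algebra_simps)
    also have "\<dots> = s * r\<^sup>2 * V + e * vol_integral A \<omega> (\<lambda>x. bump c z0 r x * f0 x)"
      unfolding V(2)[symmetric]
      by (intro vol_integral_linear[OF A cpt \<omega>] f0 continuous_on_mult smooth_fun_continuous_on[OF A bump])
    also have "e * vol_integral A \<omega> (\<lambda>x. bump c z0 r x * f0 x) \<le> E * (K * r ^ (2 * CARD('n)))"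
      using K(3)[OF r(1,3)] K(1) e r(1)
      by (intro order_trans[OF mult_left_mono mult_right_mono[OF e(2)]]) (auto simp: abs_le_iff)
    \<comment> \<open>Here 2n >= 4. The exponent 3 suffices: after factoring out r^2, one power of r
      remains to make the bump term small against s V.\<close>
    also have "E * (K * r ^ (2 * CARD('n))) \<le> E * (K * r ^ 3)"
      using E K(1) r(1,4) assms(4) by (intro mult_left_mono power_decreasing) auto
    also have "s * r\<^sup>2 * V + E * (K * r ^ 3) = r\<^sup>2 * (s * V + E * K * r)"
      by (simp add: power2_eq_square power3_eq_cube algebra_simps)
    also have "\<dots> < 0"
    proof -
      have "E * K * r \<le> (E * K + 1) * r"
        using r(1) by (simp add: algebra_simps)
      also have "\<dots> \<le> - s * V / 2"
        using r(5) EK by (simp add: field_simps)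
      also have "\<dots> < - s * V"
        using mult_neg_pos[OF s(2) V(1)] by (simp add: mult.commute)
      finally show ?thesis
        using r(1) by (simp add: mult_pos_neg)
    qed
    finally show "vol_integral A \<omega> (\<lambda>x. g x * f0 x) < 0"
      by simp
    show "\<not> (\<exists>\<omega>'. conformal A \<omega> \<omega>' \<and> (\<forall>x. chern_scalar A \<omega>' x = g x))"
    proof (rule not_conformal_chern_scalar[OF A cpt \<omega> s c(1) r(1)])
      show sub: "cball z0 r \<subseteq> chart_image c"
        using r(1) by (intro order_trans[OF subset_cball ball]) auto
      show "2 * Re (\<Sum>k\<in>UNIV. metric_inv (\<omega> c) z k k) \<le> C" if "z \<in> cball z0 r" for z
        using that r by (intro C(2)) auto
      show "s * r\<^sup>2 \<le> g x" for x
        using e(1) bump_nonneg[of c z0 r x] by (simp add: g_def)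
      show "?n / 2 * C \<le> g x" if x: "x \<in> fst c" "snd c x \<in> cball z0 r" for x
      proof -
        have "e * exp (- 1) \<le> e * bump c z0 r x"
          by (rule mult_left_mono[OF bump_ge[OF x r(1)] e(1)])
        moreover have "e * exp (- 1) = ?n / 2 * C - s * r\<^sup>2"
          by (simp add: e_def exp_minus)
        ultimately show ?thesis
          unfolding g_def by linarith
      qed
    qed
  qed
qed

end
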